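(* Let $\lambda,\mu$ be partitions with conjugates $\lambda',\mu'$ and let $m\ge\max(\ell(\lambda'),\ell(\mu'))$. Then $$\widehat s_{\lambda/\mu}(\mathbf p\,\|\,\boldsymbol\alpha;\boldsymbol\beta)=\omega\,s_{\lambda'/\mu'}(\mathbf p\,\|\,{-\iota\boldsymbol\beta};{-\iota\boldsymbol\alpha})=\prod_{i=1}^m\frac{1-\alpha_{i-\lambda_i'}\beta_{i-\lambda_i'}}{1-\alpha_{i-\mu_i'}\beta_{i-\mu_i'}}\;s_{\lambda/\mu}(\mathbf p\,\|\,\boldsymbol\beta;\boldsymbol\alpha).$$
   Context: $\boldsymbol\alpha=(\alpha_i)_{i\in\mathbb Z}$, $\boldsymbol\beta=(\beta_i)_{i\in\mathbb Z}$ are sequences in $\mathbb C$ (with $1-\alpha_i\beta_i\neq0$); $(-\iota\boldsymbol\alpha)_i=-\alpha_{1-i}$, $(-\iota\boldsymbol\beta)_i=-\beta_{1-i}$. For $k\in\mathbb Z$, $(z;\boldsymbol\alpha)^k=\prod_{i=1}^k(1-z\alpha_i)$ if $k\ge 0$ and $\prod_{i=k+1}^{0}(1-z\alpha_i)^{-1}$ if $k<0$; $(z|\boldsymbol\beta)^k=\prod_{i=1}^k(z-\beta_i)$ if $k\ge0$ and $\prod_{i=k+1}^0(z-\beta_i)^{-1}$ if $k<0$. $\omega$ is the (continuous) algebra involution of $\mathbb C[[p_1,p_2,\dots]]$ with $\omega p_k=(-1)^{k+1}p_k$. The Clifford algebra is generated by $\psi_i,\psi_i^*$ ($i\in\mathbb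 Z$) with $[\psi_i,\psi_j]_+=[\psi_i^*,\psi_j^*]_+=0$, $[\psi_i,\psi_j^*]_+=\delta_{ij}$. The charge $0$ Fock space has basis $|\lambda\rangle=v_{\lambda_1}\wedge v_{\lambda_2-1}\wedge v_{\lambda_3-2}\wedge\cdots$ over partitions; $\psi_j$ acts by $v_j\wedge$, $\psi_j^*$ by contraction against $v_j$; $\langle\lambda|$ is the dual basis. Normal ordering: $:\!\psi_i\psi_j^*\!:\,=\psi_i\psi_j^*$ if $i>0$, $=-\psi_j^*\psi_i$ if $i\le0$. Deformed currents: $J_k^{(\boldsymbol\alpha;\boldsymbol\beta)}$ is the coefficient of $z^{-k}$ in $:\!\psi(z|\boldsymbol\alpha;\boldsymbol\beta)\psi^*(z|\boldsymbol\alpha;\boldsymbol\beta)\!:$ (expanded for $|\beta_a|<|z|<|\alpha_b^{-1}|$, all $a,b$), where $\psi(z|\boldsymbol\alpha;\boldsymbol\beta)=\sum_i z\frac{(z|\boldsymbol\beta)^{i-1}}{(z;\boldsymbol\alpha)^i}\psi_i$, $\psi^*(w|\boldsymbol\alpha;\boldsymbol\beta)=\sum_j(1-\alpha_j\beta_j)\frac{(w;\boldsymbol\alpha)^{j-1}}{(w|\boldsymbol\beta)^j}\psi_j^*$. Explicitly, for $k\ne0$, $J_k^{(\boldsymbol\alpha;\boldsymbol\beta)}=\sum_{i,j}A_{ij}^k:\!\psi_i\psi_j^*\!:$ where for $k>0$, $i\ne j$: $A_{ij}^k=(1-\alpha_j\beta_j)\sum_{r-s=j-i-k}e_r(-\alpha_{i+1},\dots,-\alpha_{j-1})h_s(\beta_i,\dots,\beta_j)$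 (zero if $j<i$), $A_{ij}^{-k}=(1-\alpha_j\beta_j)\sum_{r-s=j-i+k}h_r(\alpha_j,\dots,\alpha_i)e_s(-\beta_{j+1},\dots,-\beta_{i-1})$ (zero if $j>i$), $A_{ii}^k=\beta_i^k$, $A_{ii}^{-k}=\alpha_i^k$, with $e_r,h_s$ elementary and complete homogeneous symmetric polynomials. $H_\pm(\mathbf p|\boldsymbol\alpha;\boldsymbol\beta)=\sum_{k\ge1}\frac{p_k}{k}J_{\pm k}^{(\boldsymbol\alpha;\boldsymbol\beta)}$ with indeterminates $\mathbf p=(p_1,p_2,\dots)$. Skew double factorial Schur functions and their duals: $s_{\lambda/\mu}(\mathbf p\,\|\,\boldsymbol\alpha;\boldsymbol\beta)=\langle\mu|e^{H_+(\mathbf p|\boldsymbol\alpha;\boldsymbol\beta)}|\lambda\rangle$ and $\widehat s_{\lambda/\mu}(\mathbf p\,\|\,\boldsymbol\alpha;\boldsymbol\beta)=\langle\lambda|e^{H_-(\mathbf p|\boldsymbol\alpha;\boldsymbol\beta)}|\mu\rangle$; when the parameters are changed (e.g. to $\boldsymbol\beta;\boldsymbol\alpha$) the same definitions are applied with the sequences substituted. *)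

theory Defs
  imports
    "HOL-Analysis.Analysis"
    "HOL-Library.Multiset"
    "HOL-Library.Groups_Big_Fun"
begin

section \<open>The ring of formal power series in \<open>p\<^sub>1, p\<^sub>2, \<dots>\<close>\<close>

text \<open>
  A monomial is a multiset of natural numbers in which the element \<open>n\<close> stands for the
  indeterminate \<open>p\<^bsub>n+1\<^esub>\<close>; the shift makes the indeterminates exactly \<open>p\<^sub>1, p\<^sub>2, \<dots>\<close>.
  For example, \<open>{#0, 0, 2#}\<close> is the monomial \<open>p\<^sub>1 p\<^sub>1 p\<^sub>3\<close>.
\<close>

typedef pseries = "UNIV :: (nat multiset \<Rightarrow> complex) set"
  morphisms coef Abs_pseries ..

setup_lifting type_definition_pseries

lemma pseries_eqI: "(\<And>M. coef f M = coef g M) \<Longrightarrow> f = g"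
  by (metis coef_inject ext)

definition splits :: "'a multiset \<Rightarrow> ('a multiset \<times> 'a multiset) set" where
  "splits M = {(A, B). A + B = M}"

lemma finite_submultisets: "finite {A. A \<subseteq># (M :: 'a multiset)}"
proof -
  have "{A. A \<subseteq># M} \<subseteq> (\<Union>n\<le>size M. multisets_of_size (set_mset M) n)"
    by (auto simp: multisets_of_size_def dest: size_mset_mono set_mset_mono)
  thus ?thesis
    by (rule finite_subset) (auto intro!: finite_multisets_of_size)
qed

lemma finite_splits [simp, intro]: "finite (splits M)"
proof -
  have "splits M \<subseteq> {A. A \<subseteq># M} \<times> {A. A \<subseteq># M}"
    by (auto simp: splits_def)
  thus ?thesis
    by (rule finite_subset) (auto intro: finite_submultisets)
qed

instantiation pseries :: comm_ring_1
begin

lift_definition zero_pseries :: pseries is "\<lambda>M. 0" .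

lift_definition one_pseries :: pseries is "\<lambda>M. if M = {#} then 1 else 0" .

lift_definition plus_pseries :: "pseries \<Rightarrow> pseries \<Rightarrow> pseries" is "\<lambda>f g M. f M + g M" .

lift_definition minus_pseries :: "pseries \<Rightarrow> pseries \<Rightarrow> pseries" is "\<lambda>f g M. f M - g M" .

lift_definition uminus_pseries :: "pseries \<Rightarrow> pseries" is "\<lambda>f M. - f M" .

lift_definition times_pseries :: "pseries \<Rightarrow> pseries \<Rightarrow> pseries"
  is "\<lambda>f g M. \<Sum>(A, B)\<in>splits M. f A * g B" .

instance
proof
  fix a b c :: pseries
  show "a * b * c = a * (b * c)"
  proof (rule pseries_eqI)
    fix M
    have "coef (a * b * c) M
        = (\<Sum>(X, C)\<in>splits M. \<Sum>(A, B)\<in>splits X. coef a A * coef b B * coef c C)"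
      by (simp add: times_pseries.rep_eq sum_distrib_right case_prod_unfold)
    also have "\<dots> = (\<Sum>((X, C), (A, B))\<in>(SIGMA p:splits M. splits (fst p)).
                      coef a A * coef b B * coef c C)"
      by (subst sum.Sigma [symmetric]) (auto simp: case_prod_unfold)
    also have "\<dots> = (\<Sum>((A, X), (B, C))\<in>(SIGMA p:splits M. splits (snd p)).
                      coef a A * coef b B * coef c C)"
      by (rule sum.reindex_bij_witness[where
            i = "\<lambda>((A, X), (B, C)). ((A + B, C), (A, B))" and
            j = "\<lambda>((X, C), (A, B)). ((A, B + C), (B, C))"])
         (auto simp: splits_def add_ac)
    also have "\<dots> = (\<Sum>(A, X)\<in>splits M. \<Sum>(B, C)\<in>splits X. coef a A * coef b B * coef c C)"
      by (subst sum.Sigma [symmetric]) (auto simp: case_prod_unfold)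
    also have "\<dots> = coef (a * (b * c)) M"
      by (simp add: times_pseries.rep_eq sum_distrib_left case_prod_unfold mult.assoc)
    finally show "coef (a * b * c) M = coef (a * (b * c)) M" .
  qed
  show "a * b = b * a"
    by (rule pseries_eqI, unfold times_pseries.rep_eq,
        rule sum.reindex_bij_witness[where i = prod.swap and j = prod.swap])
       (auto simp: splits_def add_ac)
  show "1 * a = a"
  proof (rule pseries_eqI)
    fix M
    have "coef (1 * a) M = (\<Sum>(A, B)\<in>{({#}, M)}. coef 1 A * coef a B)"
      unfolding times_pseries.rep_eq
      by (rule sum.mono_neutral_right[OF finite_splits])
         (auto simp: splits_def one_pseries.rep_eq split: if_splits)
    thus "coef (1 * a) M = coef a M"
      by (simp add: one_pseries.rep_eq)
  qed
  show "(a + b) * c = a * c + b * c"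
    by (rule pseries_eqI)
       (simp add: times_pseries.rep_eq plus_pseries.rep_eq case_prod_unfold
          algebra_simps sum.distrib)
  show "(0 :: pseries) \<noteq> 1"
    by transfer (auto simp: fun_eq_iff)
qed (transfer; simp add: fun_eq_iff)+

end

lift_definition const :: "complex \<Rightarrow> pseries" is "\<lambda>c M. if M = {#} then c else 0" .

text \<open>The indeterminate \<open>p\<^sub>k\<close>, for \<open>k \<ge> 1\<close>.\<close>

lift_definition pvar :: "nat \<Rightarrow> pseries" is "\<lambda>k M. if M = {#k - 1#} then 1 else 0" .

text \<open>
  Infinite sum of a family of power series, of which only finitely many members contribute to
  each given monomial.
\<close>

lift_definition formal_sum :: "('i \<Rightarrow> pseries) \<Rightarrow> pseries"
  is "\<lambda>F M. Sum_any (\<lambda>i. F i M)" .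

text \<open>
  The involution \<open>\<omega>\<close>: it multiplies the monomial \<open>\<Prod> p\<^sub>k\<close> by \<open>\<Prod> (-1)\<^bsup>k+1\<^esup>\<close>.
  The lemmas below show that it is the algebra involution with \<open>\<omega> p\<^sub>k = (-1)\<^bsup>k+1\<^esup> p\<^sub>k\<close>;
  it is continuous as it acts monomial by monomial.
\<close>

lift_definition omega :: "pseries \<Rightarrow> pseries"
  is "\<lambda>f M. (\<Prod>n\<in>#M. (-1) ^ (Suc n + 1)) * f M" .

lemma omega_add: "omega (f + g) = omega f + omega g"
  by transfer (simp add: algebra_simps)

lemma omega_mult: "omega (f * g) = omega f * omega g"
  by (rule pseries_eqI, unfold omega.rep_eq times_pseries.rep_eq sum_distrib_left,
      rule sum.cong) (auto simp: splits_def)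

lemma omega_const [simp]: "omega (const c) = const c"
  by transfer auto

lemma omega_pvar: "k \<ge> 1 \<Longrightarrow> omega (pvar k) = const ((-1) ^ (k + 1)) * pvar k"
proof (rule pseries_eqI)
  fix M assume k: "k \<ge> 1"
  have "coef (const c * f) M = c * coef f M" for c f
  proof -
    have "coef (const c * f) M = (\<Sum>(A, B)\<in>{({#}, M)}. coef (const c) A * coef f B)"
      unfolding times_pseries.rep_eq
      by (rule sum.mono_neutral_right[OF finite_splits])
         (auto simp: splits_def const.rep_eq split: if_splits)
    thus ?thesis by (simp add: const.rep_eq)
  qed
  thus "coef (omega (pvar k)) M = coef (const ((-1) ^ (k + 1)) * pvar k) M"
    using k by (cases k) (auto simp: omega.rep_eq pvar.rep_eq)
qed

lemma omega_omega [simp]: "omega (omega f) = f"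
proof (rule pseries_eqI)
  fix M
  have "(\<Prod>n\<in>#M. (-1) ^ (Suc n + 1)) * (\<Prod>n\<in>#M. (-1) ^ (Suc n + 1)) = (1 :: complex)"
    by (induction M) (auto simp: power_mult_distrib [symmetric] mult_ac)
  thus "coef (omega (omega f)) M = coef f M"
    by (simp add: omega.rep_eq mult.assoc [symmetric])
qed


section \<open>Partitions\<close>

text \<open>
  A partition is a sequence \<open>\<lambda>\<^sub>1 \<ge> \<lambda>\<^sub>2 \<ge> \<dots>\<close> with finitely many nonzero terms.
  The value at index \<open>0\<close> is never used.
\<close>

definition is_partition :: "(nat \<Rightarrow> nat) \<Rightarrow> bool" where
  "is_partition lam \<longleftrightarrow>
     (\<forall>i\<ge>1. lam (Suc i) \<le> lam i) \<and> finite {i. i \<ge> 1 \<and> lam i \<noteq> 0}"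

definition part_length :: "(nat \<Rightarrow> nat) \<Rightarrow> nat" where
  "part_length lam = card {i. i \<ge> 1 \<and> lam i \<noteq> 0}"

definition conjugate :: "(nat \<Rightarrow> nat) \<Rightarrow> nat \<Rightarrow> nat" where
  "conjugate lam j = card {i. i \<ge> 1 \<and> lam i \<ge> j}"


section \<open>Fock space\<close>

text \<open>
  The set \<open>S = {i\<^sub>1 > i\<^sub>2 > \<dots>}\<close> of integers stands for the semi-infinite wedge
  \<open>v\<^bsub>i\<^sub>1\<^esub> \<and> v\<^bsub>i\<^sub>2\<^esub> \<and> \<dots>\<close>, and a vector is the function
  giving its coefficients. Vectors may have infinite support, since the exponential of \<open>H\<^sub>-\<close> does
  not preserve the span of the wedges. Only sets \<open>S\<close> which have finitely many positive elements
  and contain almost all negative integers occur in vectors obtained from the \<open>|\<lambda>\<rangle>\<close>.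
\<close>

type_synonym fock = "int set \<Rightarrow> pseries"

definition maya :: "(nat \<Rightarrow> nat) \<Rightarrow> int set" where
  "maya lam = {int (lam i) - int i + 1 | i. i \<ge> 1}"

definition ket :: "(nat \<Rightarrow> nat) \<Rightarrow> fock" where
  "ket lam = (\<lambda>S. if S = maya lam then 1 else 0)"

definition bra :: "(nat \<Rightarrow> nat) \<Rightarrow> fock \<Rightarrow> pseries" where
  "bra mu f = f (maya mu)"

definition wedge_sign :: "int \<Rightarrow> int set \<Rightarrow> pseries" where
  "wedge_sign j S = (-1) ^ card {i \<in> S. i > j}"

text \<open>
  On wedges, \<open>\<psi>\<^sub>j v\<^sub>T = \<plusminus> v\<^bsub>T \<union> {j}\<^esub>\<close> if \<open>j \<notin> T\<close> and \<open>\<psi>\<^sub>j\<^sup>* v\<^sub>T = \<plusminus> v\<^bsub>T - {j}\<^esub>\<close> if \<open>j \<in> T\<close>,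
  with the sign of moving \<open>v\<^sub>j\<close> past the \<open>v\<^sub>i\<close> with \<open>i > j\<close>; both vanish otherwise.
  The definitions give the coefficient of \<open>v\<^sub>S\<close> in the image of \<open>f\<close>.
\<close>

definition psi :: "int \<Rightarrow> fock \<Rightarrow> fock" where
  "psi j f = (\<lambda>S. if j \<in> S then wedge_sign j S * f (S - {j}) else 0)"

definition psi_star :: "int \<Rightarrow> fock \<Rightarrow> fock" where
  "psi_star j f = (\<lambda>S. if j \<notin> S then wedge_sign j S * f (insert j S) else 0)"

definition normal_ordered :: "int \<Rightarrow> int \<Rightarrow> fock \<Rightarrow> fock" where
  "normal_ordered i j f =
     (if i > 0 then psi i (psi_star j f) else (\<lambda>S. - psi_star j (psi i f) S))"


section \<open>Deformed currents\<close>

text \<open>Elementary and complete homogeneous polynomials in the variables \<open>x\<^sub>a\<close>, \<open>a \<in> I\<close>.\<close>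

definition elem_sym :: "nat \<Rightarrow> int set \<Rightarrow> (int \<Rightarrow> complex) \<Rightarrow> complex" where
  "elem_sym r I x = (\<Sum>X | X \<subseteq> I \<and> card X = r. \<Prod>a\<in>X. x a)"

definition complete_sym :: "nat \<Rightarrow> int set \<Rightarrow> (int \<Rightarrow> complex) \<Rightarrow> complex" where
  "complete_sym s I x = (\<Sum>M\<in>multisets_of_size I s. \<Prod>a\<in>#M. x a)"

text \<open>
  \<open>current_coeff \<alpha> \<beta> k i j\<close> is \<open>A\<^sub>i\<^sub>j\<^sup>k\<close>, the coefficient of \<open>z\<^bsup>-k\<^esup> :\<psi>\<^sub>i \<psi>\<^sub>j\<^sup>*:\<close> in
  \<open>:\<psi>(z|\<alpha>;\<beta>) \<psi>\<^sup>*(z|\<alpha>;\<beta>):\<close>, for \<open>k\<close> of either sign. For \<open>i < j\<close> it comes from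
  \<open>(1 - \<alpha>\<^sub>j \<beta>\<^sub>j) z \<Prod>\<^bsub>i<a<j\<^esub> (1 - z \<alpha>\<^sub>a) / \<Prod>\<^bsub>i\<le>a\<le>j\<^esub> (z - \<beta>\<^sub>a)\<close> expanded in \<open>z\<^bsup>-1\<^esup>\<close>, for
  \<open>j < i\<close> from \<open>(1 - \<alpha>\<^sub>j \<beta>\<^sub>j) z \<Prod>\<^bsub>j<a<i\<^esub> (z - \<beta>\<^sub>a) / \<Prod>\<^bsub>j\<le>a\<le>i\<^esub> (1 - z \<alpha>\<^sub>a)\<close> expanded in \<open>z\<close>,
  and for \<open>i = j\<close> from \<open>1 / (1 - z \<alpha>\<^sub>i) + 1 / (1 - z\<^bsup>-1\<^esup> \<beta>\<^sub>i) - 1\<close>.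
\<close>

definition current_coeff ::
    "(int \<Rightarrow> complex) \<Rightarrow> (int \<Rightarrow> complex) \<Rightarrow> int \<Rightarrow> int \<Rightarrow> int \<Rightarrow> complex" where
  "current_coeff \<alpha> \<beta> k i j =
     (if k > 0 then
        if i = j then \<beta> i ^ nat k
        else if i < j then
          (1 - \<alpha> j * \<beta> j) *
          Sum_any (\<lambda>(r, s). if int r - int s = j - i - k
            then elem_sym r {i+1..j-1} (\<lambda>a. - \<alpha> a) * complete_sym s {i..j} \<beta> else 0)
        else 0
      else
        if i = j then \<alpha> i ^ nat (- k)
        else if j < i then
          (1 - \<alpha> j * \<beta> j) *
          Sum_any (\<lambda>(r, s). if int r - int s = j - i - k
            then complete_sym r {j..i} \<alpha> * elem_sym s {j+1..i-1} (\<lambda>a. - \<beta> a) else 0)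
        else 0)"

definition current ::
    "(int \<Rightarrow> complex) \<Rightarrow> (int \<Rightarrow> complex) \<Rightarrow> int \<Rightarrow> fock \<Rightarrow> fock" where
  "current \<alpha> \<beta> k f =
     (\<lambda>S. Sum_any (\<lambda>(i, j). const (current_coeff \<alpha> \<beta> k i j) * normal_ordered i j f S))"


section \<open>Skew double factorial Schur functions\<close>

definition H_plus :: "(int \<Rightarrow> complex) \<Rightarrow> (int \<Rightarrow> complex) \<Rightarrow> fock \<Rightarrow> fock" where
  "H_plus \<alpha> \<beta> f = (\<lambda>S. formal_sum (\<lambda>k :: nat.
     if k \<ge> 1 then const (1 / of_nat k) * pvar k * current \<alpha> \<beta> (int k) f S else 0))"

definition H_minus :: "(int \<Rightarrow> complex) \<Rightarrow> (int \<Rightarrow> complex) \<Rightarrow> fock \<Rightarrow> fock" where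
  "H_minus \<alpha> \<beta> f = (\<lambda>S. formal_sum (\<lambda>k :: nat.
     if k \<ge> 1 then const (1 / of_nat k) * pvar k * current \<alpha> \<beta> (- int k) f S else 0))"

definition exp_op :: "(fock \<Rightarrow> fock) \<Rightarrow> fock \<Rightarrow> fock" where
  "exp_op H f = (\<lambda>S. formal_sum (\<lambda>n :: nat. const (1 / fact n) * (H ^^ n) f S))"

definition skew_schur ::
    "(int \<Rightarrow> complex) \<Rightarrow> (int \<Rightarrow> complex) \<Rightarrow> (nat \<Rightarrow> nat) \<Rightarrow> (nat \<Rightarrow> nat) \<Rightarrow> pseries" where
  "skew_schur \<alpha> \<beta> lam mu = bra mu (exp_op (H_plus \<alpha> \<beta>) (ket lam))"

definition dual_skew_schur ::
    "(int \<Rightarrow> complex) \<Rightarrow> (int \<Rightarrow> complex) \<Rightarrow> (nat \<Rightarrow> nat) \<Rightarrow> (nat \<Rightarrow> nat) \<Rightarrow> pseries" where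
  "dual_skew_schur \<alpha> \<beta> lam mu = bra lam (exp_op (H_minus \<alpha> \<beta>) (ket mu))"

text \<open>The sequence \<open>-\<iota>\<alpha>\<close>.\<close>

definition neg_iota :: "(int \<Rightarrow> complex) \<Rightarrow> int \<Rightarrow> complex" where
  "neg_iota \<alpha> i = - \<alpha> (1 - i)"

end

theory Submission
  imports Defs
begin

text \<open>
  All three functions are built from powers of operators \<open>\<Sum> p\<^sub>k/k \<Sum> A\<^sup>k\<^sub>i\<^sub>j :\<psi>\<^sub>i \<psi>\<^sub>j\<^sup>*:\<close>, and they are
  compared power by power on the level of matrix elements. A bilinear \<open>:\<psi>\<^sub>i \<psi>\<^sub>j\<^sup>*:\<close> lets a single
  particle hop from \<open>j\<close> to \<open>i\<close>, with a sign for the particles that it passes, and the argument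
  rests on two symmetries of these hops.

  \<^item> Reversing a hop leaves its sign unchanged, so the transpose of \<open>:\<psi>\<^sub>i \<psi>\<^sub>j\<^sup>*:\<close> is \<open>:\<psi>\<^sub>j \<psi>\<^sub>i\<^sup>*:\<close>. The
    matrix of \<open>J\<^bsub>-k\<^esub>\<close> for \<open>\<alpha>; \<beta>\<close> is the transpose of that of \<open>J\<^sub>k\<close> for \<open>\<beta>; \<alpha>\<close>, up to conjugation by
    the diagonal matrix with entries \<open>1 - \<alpha>\<^sub>i\<beta>\<^sub>i\<close> (\<open>current_coeff_swap\<close>). On a wedge this diagonal
    matrix acts by the product of its entries over the occupied places. Only ratios of such
    products occur, and a ratio over particles is the inverse ratio over holes, which are the places
    \<open>i - \<lambda>'\<^sub>i\<close>. This is the product in the theorem.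

  \<^item> Exchanging particles with holes and reflecting the line turns \<open>|\<lambda>\<rangle>\<close> into \<open>|\<lambda>'\<rangle>\<close>
    (\<open>maya_conjugate\<close>) and a hop from \<open>j\<close> to \<open>i\<close> into one from \<open>1 - i\<close> to \<open>1 - j\<close>, with the sign
    \<open>(-1)\<^bsup>\<bar>i - j\<bar> + 1\<^esup>\<close> (\<open>amplitude_particle_hole\<close>). The matrix of \<open>J\<^sub>k\<close> for \<open>-\<iota>\<beta>; -\<iota>\<alpha>\<close> is reflected in
    the same way to the transpose of that of \<open>J\<^bsub>-k\<^esub>\<close> for \<open>\<alpha>; \<beta>\<close>, with the sign \<open>(-1)\<^bsup>\<bar>i - j\<bar> + k\<^esup>\<close>
    (\<open>current_coeff_neg_iota\<close>). Together the signs give \<open>(-1)\<^bsup>k+1\<^esup>\<close>, which is the effect of \<open>\<omega>\<close> on \<open>p\<^sub>k\<close>.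

  Transposing powers of operators requires sums over intermediate states to be finite. Currents
  \<open>J\<^sub>k\<close> with \<open>k > 0\<close> only move particles downwards, and the sets reached from a given one in this way
  lie in a finite set of wedges (\<open>window\<close>). On it the two operators are adjoint for a weighted
  bilinear form (\<open>hamiltonian_funpow_adjoint\<close>), with trivial weights for the first equality and
  weights \<open>1 - \<alpha>\<^sub>i\<beta>\<^sub>i\<close> for the second. Particle-hole exchange matches the sums term by term.
\<close>

section \<open>Linearity of infinite sums of power series\<close>

text \<open>
  \<open>Sum_any\<close> is \<open>0\<close> on families with infinite support. An injective additive map preserves the support,
  so it commutes with \<open>Sum_any\<close> without any finiteness condition. This covers multiplication by a
  nonzero scalar and the involution \<open>\<omega>\<close>.
\<close>

lemma Sum_any_hom:
  assumes "h 0 = 0" "\<And>x y. h (x + y) = h x + h y" "\<And>x. h x = 0 \<Longrightarrow> x = 0"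
  shows "Sum_any (\<lambda>i. h (F i)) = h (Sum_any F)"
proof -
  have "h (sum F A) = (\<Sum>i\<in>A. h (F i))" if "finite A" for A
    using that by (induction A) (auto simp: assms(1,2))
  moreover have supp: "{i. h (F i) \<noteq> 0} = {i. F i \<noteq> 0}"
    using assms(1,3) by auto
  ultimately show ?thesis
    by (cases "finite {i. F i \<noteq> 0}") (auto simp: Sum_any.expand_set assms(1))
qed

lemma Sum_any_mult_nonzero:
  fixes c :: complex
  assumes "c \<noteq> 0"
  shows "Sum_any (\<lambda>i. c * F i) = c * Sum_any F"
  by (rule Sum_any_hom) (use assms in \<open>auto simp: algebra_simps\<close>)

lemma coef_zero [simp]: "coef 0 M = 0"
  and coef_add [simp]: "coef (f + g) M = coef f M + coef g M"
  by (simp_all add: zero_pseries.rep_eq plus_pseries.rep_eq)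

lemma coef_sum: "coef (sum F A) M = (\<Sum>i\<in>A. coef (F i) M)"
  by (induction A rule: infinite_finite_induct) auto

lemma const_0 [simp]: "const 0 = 0" and const_1 [simp]: "const 1 = 1"
  by (transfer; auto)+

lemma const_minus: "const (- x) = - const x"
  by transfer auto

lemma coef_const_mult [simp]: "coef (const c * f) M = c * coef f M"
proof -
  have "coef (const c * f) M = (\<Sum>(A, B)\<in>{({#}, M)}. coef (const c) A * coef f B)"
    unfolding times_pseries.rep_eq
    by (rule sum.mono_neutral_right[OF finite_splits])
       (auto simp: splits_def const.rep_eq split: if_splits)
  thus ?thesis by (simp add: const.rep_eq)
qed

lemma const_mult: "const (x * y) = const x * const y"
  by (rule pseries_eqI) (simp add: const.rep_eq)

lemma const_mult_mult: "const x * (const y * f) = const (x * y) * f"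
  by (simp add: const_mult mult.assoc)

lemma const_minus_one_power: "const ((-1) ^ n) = (-1) ^ n"
  by (induction n) (auto simp: const_mult const_minus)

lemma const_mult_eq_0: "const c * f = 0 \<Longrightarrow> c \<noteq> 0 \<Longrightarrow> f = 0"
  by (metis const_mult_mult const_1 left_inverse mult_1 mult_zero_right)

lemma omega_0 [simp]: "omega 0 = 0" and omega_1 [simp]: "omega 1 = 1"
  using omega_const[of 0] omega_const[of 1] by (simp_all del: omega_const)

lemma omega_eq_0: "omega f = 0 \<Longrightarrow> f = 0"
  by (metis omega_omega omega_0)

lemma formal_sum_omega: "formal_sum (\<lambda>i. omega (F i)) = omega (formal_sum F)"
proof (rule pseries_eqI)
  fix M
  define c :: complex where "c = (\<Prod>n\<in>#M. (-1) ^ (Suc n + 1))"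
  have "c \<noteq> 0"
    by (auto simp: c_def prod_mset_zero_iff)
  thus "coef (formal_sum (\<lambda>i. omega (F i))) M = coef (omega (formal_sum F)) M"
    unfolding formal_sum.rep_eq omega.rep_eq c_def[symmetric] by (rule Sum_any_mult_nonzero)
qed

lemma formal_sum_const_mult:
  assumes "c \<noteq> 0"
  shows "formal_sum (\<lambda>i. const c * F i) = const c * formal_sum F"
  by (rule pseries_eqI) (simp add: formal_sum.rep_eq Sum_any_mult_nonzero assms)

text \<open>
  Multiplication by an arbitrary series and finite sums, by contrast, commute with infinite sums
  only when each monomial receives finitely many contributions.
\<close>

definition locally_finite :: "('i \<Rightarrow> pseries) \<Rightarrow> bool" where
  "locally_finite F \<longleftrightarrow> (\<forall>M. finite {i. coef (F i) M \<noteq> 0})"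

lemma locally_finite_mult:
  assumes "locally_finite F"
  shows "locally_finite (\<lambda>i. c * F i)"
  unfolding locally_finite_def
proof
  fix M
  have "{i. coef (c * F i) M \<noteq> 0} \<subseteq> (\<Union>(A, B)\<in>splits M. {i. coef (F i) B \<noteq> 0})"
    unfolding times_pseries.rep_eq
    by (auto elim!: sum.not_neutral_contains_not_neutral)
  moreover have "finite \<dots>"
    using assms by (auto simp: locally_finite_def)
  ultimately show "finite {i. coef (c * F i) M \<noteq> 0}"
    by (rule finite_subset)
qed

lemma formal_sum_mult:
  assumes "locally_finite F"
  shows "formal_sum (\<lambda>i. c * F i) = c * formal_sum F"
proof (rule pseries_eqI)
  fix M
  define I where "I = (\<Union>(A, B)\<in>splits M. {i. coef (F i) B \<noteq> 0})"
  have "finite I"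
    using assms by (auto simp: locally_finite_def I_def)
  have I: "Sum_any (\<lambda>i. coef (F i) B) = (\<Sum>i\<in>I. coef (F i) B)" if "(A, B) \<in> splits M" for A B
    using that \<open>finite I\<close> by (intro Sum_any.expand_superset) (auto simp: I_def)
  have "coef (formal_sum (\<lambda>i. c * F i)) M = (\<Sum>i\<in>I. coef (c * F i) M)"
    unfolding formal_sum.rep_eq
    by (rule Sum_any.expand_superset[OF \<open>finite I\<close>])
       (auto simp: times_pseries.rep_eq I_def elim!: sum.not_neutral_contains_not_neutral)
  also have "\<dots> = (\<Sum>p\<in>splits M. \<Sum>i\<in>I. coef c (fst p) * coef (F i) (snd p))"
    by (simp add: times_pseries.rep_eq case_prod_unfold sum.swap[of _ I])
  also have "\<dots> = (\<Sum>p\<in>splits M. coef c (fst p) * coef (formal_sum F) (snd p))"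
    by (rule sum.cong) (auto simp: formal_sum.rep_eq I sum_distrib_left)
  finally show "coef (formal_sum (\<lambda>i. c * F i)) M = coef (c * formal_sum F) M"
    by (simp add: times_pseries.rep_eq case_prod_unfold)
qed

lemma formal_sum_sum:
  assumes "finite X" "\<And>x. x \<in> X \<Longrightarrow> locally_finite (F x)"
  shows "formal_sum (\<lambda>i. \<Sum>x\<in>X. F x i) = (\<Sum>x\<in>X. formal_sum (F x))"
proof (rule pseries_eqI)
  fix M
  define I where "I = (\<Union>x\<in>X. {i. coef (F x i) M \<noteq> 0})"
  have "finite I"
    using assms by (auto simp: locally_finite_def I_def)
  have "coef (formal_sum (\<lambda>i. \<Sum>x\<in>X. F x i)) M = (\<Sum>i\<in>I. \<Sum>x\<in>X. coef (F x i) M)"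
    unfolding formal_sum.rep_eq coef_sum
    by (rule Sum_any.expand_superset[OF \<open>finite I\<close>])
       (auto simp: I_def elim!: sum.not_neutral_contains_not_neutral)
  also have "\<dots> = (\<Sum>x\<in>X. \<Sum>i\<in>I. coef (F x i) M)"
    by (rule sum.swap)
  also have "\<dots> = (\<Sum>x\<in>X. coef (formal_sum (F x)) M)"
    unfolding formal_sum.rep_eq
    by (intro sum.cong refl Sum_any.expand_superset[symmetric] \<open>finite I\<close>) (auto simp: I_def)
  finally show "coef (formal_sum (\<lambda>i. \<Sum>x\<in>X. F x i)) M = coef (\<Sum>x\<in>X. formal_sum (F x)) M"
    by (simp add: coef_sum)
qed

text \<open>
  The factor \<open>p\<^sub>k\<close> makes every series \<open>\<Sum> p\<^sub>k f\<^sub>k\<close> converge: a given monomial is divisible by only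
  finitely many \<open>p\<^sub>k\<close>.
\<close>

lemma coef_pvar_mult_eq_0:
  assumes "k - 1 \<notin># M"
  shows "coef (pvar k * f) M = 0"
  unfolding times_pseries.rep_eq using assms
  by (intro sum.neutral) (auto simp: splits_def pvar.rep_eq)

lemma locally_finite_pvar:
  "locally_finite (\<lambda>k :: nat. if k \<ge> 1 then const (c k) * pvar k * F k else 0)"
  unfolding locally_finite_def
proof
  fix M
  have "{k. coef (if k \<ge> 1 then const (c k) * pvar k * F k else 0) M \<noteq> 0} \<subseteq> Suc ` set_mset M"
  proof clarsimp
    fix k :: nat
    assume k: "Suc 0 \<le> k" and "coef (const (c k) * pvar k * F k) M \<noteq> 0"
    hence "k - 1 \<in># M"
      using coef_pvar_mult_eq_0[of k M "F k"] by (auto simp: mult.assoc)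
    thus "k \<in> Suc ` set_mset M"
      using k by (intro image_eqI[of _ _ "k - 1"]) auto
  qed
  thus "finite {k. coef (if k \<ge> 1 then const (c k) * pvar k * F k else 0) M \<noteq> 0}"
    by (rule finite_subset) simp
qed


section \<open>Matrix elements of normally ordered bilinears\<close>

text \<open>
  On wedges, \<open>:\<psi>\<^sub>i \<psi>\<^sub>j\<^sup>*:\<close> relates \<open>S\<close> to the single set \<open>move i j S\<close>, in which the particle at
  \<open>i\<close> has been put back to \<open>j\<close>. For \<open>i = j\<close> normal ordering gives an eigenvalue also when \<open>i \<notin> S\<close>,
  so that \<open>move i i S\<close> has to be \<open>S\<close> rather than \<open>insert i S\<close>.
\<close>

definition move :: "int \<Rightarrow> int \<Rightarrow> int set \<Rightarrow> int set" where
  "move i j S = (if i = j then S else insert j (S - {i}))"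

definition amplitude :: "int \<Rightarrow> int \<Rightarrow> int set \<Rightarrow> complex" where
  "amplitude i j S =
     (if i = j then (if i > 0 \<and> i \<in> S then 1 else if i \<le> 0 \<and> i \<notin> S then -1 else 0)
      else if i \<in> S \<and> j \<notin> S then (-1) ^ card (S \<inter> {min i j<..<max i j}) else 0)"

lemma amplitude_nonzeroD: "amplitude i j S \<noteq> 0 \<Longrightarrow> i \<noteq> j \<Longrightarrow> i \<in> S \<and> j \<notin> S"
  by (auto simp: amplitude_def split: if_splits)

lemma minus_one_power_self: "(-1) ^ n * ((-1) ^ n * f) = (f :: 'a :: comm_ring_1)"
  by (simp add: mult.assoc[symmetric] power_mult_distrib[symmetric])

lemma wedge_sign_split:
  assumes "S \<subseteq> {..b}" "i < j" "j \<notin> S"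
  shows "wedge_sign i S = const ((-1) ^ card (S \<inter> {i<..<j})) * wedge_sign j S"
proof -
  have fin: "finite {x \<in> S. x > c}" for c
    by (rule finite_subset[of _ "{c..b}"]) (use assms(1) in auto)
  have "{x \<in> S. x > i} = (S \<inter> {i<..<j}) \<union> {x \<in> S. x > j}"
    using assms by (auto simp: not_less le_less)
  hence "card {x \<in> S. x > i} = card (S \<inter> {i<..<j}) + card {x \<in> S. x > j}"
    by (simp only:) (rule card_Un_disjoint, use fin in \<open>auto intro: finite_subset\<close>)
  thus ?thesis
    by (simp add: wedge_sign_def power_add const_minus_one_power)
qed

lemma wedge_sign_cong: "(\<And>x. x > i \<Longrightarrow> x \<in> S \<longleftrightarrow> x \<in> T) \<Longrightarrow> wedge_sign i S = wedge_sign i T"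
  unfolding wedge_sign_def by (intro arg_cong[where f = "\<lambda>X. (-1) ^ card X"]) auto

lemma wedge_sign_insert:
  assumes "S \<subseteq> {..b}" "j < i" "i \<notin> S"
  shows "wedge_sign j (insert i S) = - wedge_sign j S"
proof -
  have "finite {x \<in> S. x > j}"
    by (rule finite_subset[of _ "{j..b}"]) (use assms(1) in auto)
  moreover have "{x \<in> insert i S. x > j} = insert i {x \<in> S. x > j}"
    using assms by auto
  ultimately show ?thesis
    using assms by (simp add: wedge_sign_def)
qed

text \<open>
  Both wedge signs count the particles above their place, and those above \<open>i\<close> and \<open>j\<close> cancel, so
  that only the particles strictly between them remain.
\<close>

lemma psi_psi_star:
  assumes "S \<subseteq> {..b}" "i \<noteq> j"
  shows "psi i (psi_star j f) S = const (amplitude i j S) * f (move i j S)"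
proof (cases "i \<in> S \<and> j \<notin> S")
  case True
  define T where "T = S - {i}"
  have T: "S = insert i T" "i \<notin> T" "j \<notin> T" "T \<subseteq> {..b}"
    using True assms by (auto simp: T_def)
  have sq: "wedge_sign c T * (wedge_sign c T * g) = g" for c g
    by (simp add: wedge_sign_def minus_one_power_self)
  have eq: "wedge_sign i S = wedge_sign i T"
    by (rule wedge_sign_cong) (auto simp: T)
  have "wedge_sign i S * wedge_sign j T = const (amplitude i j S)"
  proof (cases "i < j")
    case lt: True
    have "S \<inter> {i<..<j} = T \<inter> {i<..<j}"
      by (auto simp: T)
    thus ?thesis
      using wedge_sign_split[OF T(4) lt T(3)] lt True sq[of j 1] eq
      by (simp add: amplitude_def mult.assoc)
  next
    case False
    hence lt: "j < i" using assms by simp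
    have "S \<inter> {j<..<i} = T \<inter> {j<..<i}"
      by (auto simp: T)
    thus ?thesis
      using wedge_sign_split[OF T(4) lt T(2)] lt True eq sq[of i 1]
      by (simp add: amplitude_def mult.left_commute[of "wedge_sign i T" "const x" for x])
  qed
  thus ?thesis
    using True assms by (simp add: psi_def psi_star_def move_def T_def flip: mult.assoc)
qed (use assms in \<open>auto simp: psi_def psi_star_def amplitude_def\<close>)

text \<open>
  The anticommutator of \<open>\<psi>\<^sub>i\<close> and \<open>\<psi>\<^sub>j\<^sup>*\<close> vanishes for \<open>i \<noteq> j\<close>, so that normal ordering matters only
  on the diagonal.
\<close>

lemma psi_star_psi:
  assumes "S \<subseteq> {..b}" "i \<noteq> j"
  shows "psi_star j (psi i f) S = - psi i (psi_star j f) S"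
proof (cases "i \<in> S \<and> j \<notin> S")
  case True
  define T where "T = S - {i}"
  have T: "S = insert i T" "i \<notin> T" "j \<notin> T" "T \<subseteq> {..b}"
    using True assms by (auto simp: T_def)
  have "wedge_sign j S * wedge_sign i (insert j S) = - (wedge_sign i S * wedge_sign j T)"
  proof (cases "i < j")
    case lt: True
    have "wedge_sign j S = wedge_sign j T"
      by (rule wedge_sign_cong) (use lt in \<open>auto simp: T\<close>)
    moreover have "wedge_sign i (insert j S) = - wedge_sign i S"
      by (rule wedge_sign_insert[of _ b]) (use lt True assms in auto)
    ultimately show ?thesis by simp
  next
    case False
    hence lt: "j < i" using assms by simp
    have "wedge_sign i (insert j S) = wedge_sign i S"
      by (rule wedge_sign_cong) (use lt in auto)
    moreover have "wedge_sign j S = - wedge_sign j T"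
      unfolding T(1) by (rule wedge_sign_insert[of _ b]) (use lt T in auto)
    ultimately show ?thesis by simp
  qed
  moreover have "insert j S - {i} = insert j T"
    using assms by (auto simp: T_def)
  ultimately show ?thesis
    using True assms T(3) by (simp add: psi_def psi_star_def T_def flip: mult.assoc)
qed (use assms in \<open>auto simp: psi_def psi_star_def\<close>)

lemma normal_ordered_eq:
  assumes "S \<subseteq> {..b}"
  shows "normal_ordered i j f S = const (amplitude i j S) * f (move i j S)"
proof (cases "i = j")
  case False
  thus ?thesis
    using psi_psi_star[OF assms False] psi_star_psi[OF assms False]
    by (simp add: normal_ordered_def)
next
  case True
  have "wedge_sign i S * (wedge_sign i (S - {i}) * f S) = f S"
    and "wedge_sign i S * (wedge_sign i (insert i S) * f S) = f S"
    using wedge_sign_cong[of i S "S - {i}"] wedge_sign_cong[of i S "insert i S"]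
    by (simp_all add: wedge_sign_def minus_one_power_self)
  thus ?thesis
    using True
    by (auto simp: normal_ordered_def psi_def psi_star_def amplitude_def move_def insert_absorb const_minus)
qed

text \<open>
  Vectors supported on a given family of sets must vanish at every other set, including those
  that are unbounded above, where a wedge sign counts an infinite set as empty. This is what
  controls them there.
\<close>

lemma normal_ordered_support:
  assumes "normal_ordered i j f S \<noteq> 0"
  shows "f (move i j S) \<noteq> 0" "i \<noteq> j \<Longrightarrow> i \<in> S \<and> j \<notin> S"
proof -
  show "i \<noteq> j \<Longrightarrow> i \<in> S \<and> j \<notin> S"
    using assms by (auto simp: normal_ordered_def psi_def psi_star_def split: if_splits)
  show "f (move i j S) \<noteq> 0"
  proof (cases "i = j")
    case True
    have "insert i S - {i} = S" if "i \<notin> S" using that by auto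
    moreover have "insert i (S - {i}) = S" if "i \<in> S" using that by auto
    ultimately show ?thesis
      using assms True
      by (cases "i \<in> S"; cases "i > 0") (auto simp: normal_ordered_def psi_def psi_star_def move_def)
  next
    case False
    hence eq: "insert j S - {i} = insert j (S - {i})"
      by auto
    have "psi i (psi_star j f) S = 0 \<and> psi_star j (psi i f) S = 0" if "f (insert j (S - {i})) = 0"
      unfolding psi_def psi_star_def eq that by simp
    thus ?thesis
      using assms False by (metis normal_ordered_def move_def neg_equal_0_iff_equal)
  qed
qed

text \<open>
  Only the matrices \<open>A\<^sup>k\<close> of the currents enter the argument, so currents and Hamiltonians are taken
  with arbitrary matrices: the transpose of a current is again such an operator, although it is not
  a current itself.
\<close>

definition fermion_bilinear :: "(int \<Rightarrow> int \<Rightarrow> complex) \<Rightarrow> fock \<Rightarrow> fock" where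
  "fermion_bilinear C f = (\<lambda>S. Sum_any (\<lambda>(i, j). const (C i j) * normal_ordered i j f S))"

definition hamiltonian :: "(nat \<Rightarrow> int \<Rightarrow> int \<Rightarrow> complex) \<Rightarrow> fock \<Rightarrow> fock" where
  "hamiltonian K f = (\<lambda>S. formal_sum (\<lambda>k :: nat.
     if k \<ge> 1 then const (1 / of_nat k) * pvar k * fermion_bilinear (K k) f S else 0))"

lemma H_plus_eq: "H_plus \<alpha> \<beta> = hamiltonian (\<lambda>k. current_coeff \<alpha> \<beta> (int k))"
  and H_minus_eq: "H_minus \<alpha> \<beta> = hamiltonian (\<lambda>k. current_coeff \<alpha> \<beta> (- int k))"
  by (intro ext, simp add: H_plus_def H_minus_def hamiltonian_def fermion_bilinear_def current_def cong: if_cong)+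


section \<open>Raising and lowering operators as adjoints\<close>

text \<open>
  An operator with an infinite upper triangular matrix has finite sums as values only on suitable
  vectors. The window supplies these: it is a finite set of wedges, and moving a particle of a set
  in the window downwards to a free place never leaves it, since all places up to \<open>a\<close> are occupied.
  On vectors supported on the window, lowering operators become finite matrices. The condition
  \<open>a \<le> 0 \<le> b\<close> below makes the diagonal terms, whose sign depends on the comparison with \<open>0\<close>, vanish
  outside of \<open>{a<..b}\<close>.
\<close>

definition window :: "int \<Rightarrow> int \<Rightarrow> int set set" where
  "window a b = {S. {..a} \<subseteq> S \<and> S \<subseteq> {..b}}"

lemma finite_window: "finite (window a b)"
proof (rule finite_subset)
  show "window a b \<subseteq> (\<lambda>T. T \<union> {..a}) ` Pow {a<..b}"
  proof
    fix S assume "S \<in> window a b"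
    hence "S = (S \<inter> {a<..b}) \<union> {..a}"
      by (auto simp: window_def)
    thus "S \<in> (\<lambda>T. T \<union> {..a}) ` Pow {a<..b}"
      by blast
  qed
qed auto

lemma amplitude_inside_window:
  assumes "a \<le> 0" "0 \<le> b" "S \<in> window a b" "amplitude i j S \<noteq> 0" "j \<le> i"
  shows "i \<in> {a<..b} \<and> j \<in> {a<..b}"
proof (cases "i = j")
  case True
  with assms(3,4) have "i > 0 \<and> i \<le> b \<or> i \<le> 0 \<and> i \<notin> {..a}"
    by (auto simp: window_def amplitude_def split: if_splits)
  thus ?thesis
    using True assms(1,2) by auto
next
  case False
  with assms(3) amplitude_nonzeroD[OF assms(4)] have "i \<le> b" "j \<notin> {..a}"
    by (auto simp: window_def)
  thus ?thesis
    using assms(5) by auto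
qed

lemma move_in_window:
  assumes "S \<in> window a b" "i \<in> {a<..b}" "j \<in> {a<..b}"
  shows "move i j S \<in> window a b"
  using assms by (auto simp: window_def move_def)

lemma move_into_window_inside:
  assumes "a \<le> 0" "0 \<le> b" "i < j" "i \<in> S" "j \<notin> S" "move i j S \<in> window a b"
  shows "i \<in> {a<..b} \<and> j \<in> {a<..b}" "S \<in> window a b"
proof -
  have "{..a} \<subseteq> insert j (S - {i})" "insert j (S - {i}) \<subseteq> {..b}"
    using assms by (auto simp: window_def move_def)
  moreover have "i \<notin> {..a}"
    using calculation assms(3) by auto
  ultimately show "i \<in> {a<..b} \<and> j \<in> {a<..b}" "S \<in> window a b"
    using assms(3-5) by (auto simp: window_def)
qed

lemma amplitude_move:
  assumes "i \<in> S" "j \<notin> S"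
  shows "amplitude j i (move i j S) = amplitude i j S"
proof -
  have "insert j (S - {i}) \<inter> {min j i<..<max j i} = S \<inter> {min i j<..<max i j}"
    by (auto simp: min_def max_def)
  thus ?thesis
    using assms by (auto simp: amplitude_def move_def)
qed

lemma move_move: "amplitude i j S \<noteq> 0 \<Longrightarrow> move j i (move i j S) = S"
  by (auto simp: amplitude_def move_def split: if_splits)

lemma amplitude_reverse: "amplitude i j S \<noteq> 0 \<Longrightarrow> amplitude j i (move i j S) = amplitude i j S"
  using amplitude_move[of i S j] amplitude_nonzeroD[of i j S] by (cases "i = j") (auto simp: move_def)

lemma fermion_bilinear_window:
  assumes "a \<le> 0" "0 \<le> b" "S \<in> window a b"
    and inside: "\<And>i j. C i j \<noteq> 0 \<Longrightarrow> amplitude i j S \<noteq> 0 \<Longrightarrow> f (move i j S) \<noteq> 0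
                   \<Longrightarrow> i \<in> {a<..b} \<and> j \<in> {a<..b}"
  shows "fermion_bilinear C f S =
    (\<Sum>(i, j)\<in>{a<..b} \<times> {a<..b}. const (C i j * amplitude i j S) * f (move i j S))"
proof -
  have "S \<subseteq> {..b}"
    using assms(3) by (simp add: window_def)
  hence "fermion_bilinear C f S = Sum_any (\<lambda>(i, j). const (C i j * amplitude i j S) * f (move i j S))"
    by (simp add: fermion_bilinear_def normal_ordered_eq const_mult_mult)
  also have "\<dots> = (\<Sum>(i, j)\<in>{a<..b} \<times> {a<..b}. const (C i j * amplitude i j S) * f (move i j S))"
  proof (rule Sum_any.expand_superset)
    show "{ij. (case ij of (i, j) \<Rightarrow> const (C i j * amplitude i j S) * f (move i j S)) \<noteq> 0}
            \<subseteq> {a<..b} \<times> {a<..b}"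
    proof clarify
      fix i j assume "const (C i j * amplitude i j S) * f (move i j S) \<noteq> 0"
      hence "C i j \<noteq> 0" "amplitude i j S \<noteq> 0" "f (move i j S) \<noteq> 0"
        by auto
      thus "i \<in> {a<..b} \<and> j \<in> {a<..b}"
        by (rule inside)
    qed
  qed auto
  finally show ?thesis .
qed

definition supported_on :: "int set set \<Rightarrow> fock \<Rightarrow> bool" where
  "supported_on X g \<longleftrightarrow> (\<forall>S. S \<notin> X \<longrightarrow> g S = 0)"

text \<open>
  If a particle of \<open>S\<close> can hop upwards from \<open>i\<close> to \<open>j\<close> into a set of the window, then \<open>S\<close> arises from
  that set by a hop downwards, and hence lies in the window too.
\<close>

lemma fermion_bilinear_supported:
  assumes "a \<le> 0" "0 \<le> b" "\<And>i j. j < i \<Longrightarrow> C i j = 0" "supported_on (window a b) g"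
  shows "supported_on (window a b) (fermion_bilinear C g)"
  unfolding supported_on_def
proof (intro allI impI)
  fix S assume S: "S \<notin> window a b"
  have "const (C i j) * normal_ordered i j g S = 0" for i j
  proof (rule ccontr)
    assume "\<not> ?thesis"
    hence ij: "C i j \<noteq> 0" "normal_ordered i j g S \<noteq> 0"
      by auto
    hence le: "i \<le> j"
      using assms(3) by (meson linorder_not_le)
    have mv: "move i j S \<in> window a b"
      using normal_ordered_support(1)[OF ij(2)] assms(4) by (auto simp: supported_on_def)
    with S have "i \<noteq> j"
      by (auto simp: move_def)
    with normal_ordered_support(2)[OF ij(2)] le mv S show False
      using move_into_window_inside(2)[OF assms(1,2)] by (metis order_le_neq_trans)
  qed
  thus "fermion_bilinear C g S = 0"
    by (simp add: fermion_bilinear_def case_prod_unfold)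
qed

text \<open>
  The eigenvalue on \<open>v\<^sub>S\<close> of the diagonal operator that multiplies each \<open>v\<^sub>x\<close> by \<open>d\<^sub>x\<close>. The infinite
  product makes no sense in general; restricting it to the window changes it only by a factor that
  is the same for all \<open>S\<close> in the window.
\<close>

definition weight :: "(int \<Rightarrow> complex) \<Rightarrow> int \<Rightarrow> int \<Rightarrow> int set \<Rightarrow> complex" where
  "weight d a b S = (\<Prod>x\<in>S \<inter> {a<..b}. d x)"

lemma weight_move:
  assumes "i \<in> {a<..b}" "j \<in> {a<..b}" "amplitude i j S \<noteq> 0"
  shows "weight d a b (move i j S) * d i = weight d a b S * d j"
proof (cases "i = j")
  case False
  hence ij: "i \<in> S" "j \<notin> S"
    using amplitude_nonzeroD[OF assms(3)] by auto
  define U where "U = (S - {i}) \<inter> {a<..b}"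
  have "S \<inter> {a<..b} = insert i U" "move i j S \<inter> {a<..b} = insert j U"
    using ij assms False by (auto simp: U_def move_def)
  moreover have "finite U" "i \<notin> U" "j \<notin> U"
    using ij by (auto simp: U_def)
  ultimately show ?thesis
    by (simp add: weight_def mult_ac)
qed (simp add: move_def)

text \<open>
  The operators with matrices \<open>A\<close> and \<open>B\<close> are adjoint for the form in which the wedges are
  orthogonal and \<open>v\<^sub>S\<close> has square \<open>weight d a b S\<close>, whenever \<open>B\<close> is the transpose of \<open>A\<close> conjugated by
  the diagonal matrix \<open>d\<close>. Both sides are sums over hops between two sets of the window, and
  reversing each hop identifies them.
\<close>

lemma fermion_bilinear_adjoint:
  assumes ab: "a \<le> 0" "0 \<le> b" and supp: "supported_on (window a b) g"
    and d: "\<And>i. d i \<noteq> 0"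
    and tri: "\<And>i j. j < i \<Longrightarrow> B i j = 0"
    and AB: "\<And>i j. A j i * d j = B i j * d i"
  shows "(\<Sum>S\<in>window a b. const (weight d a b S) * g S * fermion_bilinear A f S)
       = (\<Sum>S\<in>window a b. const (weight d a b S) * fermion_bilinear B g S * f S)"
proof -
  let ?X = "window a b" and ?W = "{a<..b}" and ?D = "weight d a b"
  have triA: "A i j = 0" if "i < j" for i j
    by (metis AB d mult_eq_0_iff tri that)
  have A: "fermion_bilinear A f S = (\<Sum>(i, j)\<in>?W \<times> ?W. const (A i j * amplitude i j S) * f (move i j S))"
    if "S \<in> ?X" for S
    by (rule fermion_bilinear_window[OF ab that])
       (meson amplitude_inside_window ab that triA linorder_not_le)
  have B: "fermion_bilinear B g S = (\<Sum>(i, j)\<in>?W \<times> ?W. const (B i j * amplitude i j S) * g (move i j S))"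
    if S: "S \<in> ?X" for S
  proof (rule fermion_bilinear_window[OF ab S])
    fix i j assume ij: "B i j \<noteq> 0" "amplitude i j S \<noteq> 0" "g (move i j S) \<noteq> 0"
    hence "move i j S \<in> ?X"
      using supp by (auto simp: supported_on_def)
    moreover have "i \<le> j"
      using ij(1) tri by (meson linorder_not_le)
    ultimately show "i \<in> ?W \<and> j \<in> ?W"
      using ij(2) amplitude_inside_window[OF ab S ij(2)] move_into_window_inside(1)[OF ab, of i j S]
        amplitude_nonzeroD[OF ij(2)]
      by (cases "i = j") auto
  qed
  \<comment> \<open>Forbidden hops, which cannot be reversed: \<open>move j i\<close> undoes \<open>move i j\<close> only on allowed ones.\<close>
  define N where "N = {(S, i, j). S \<in> ?X \<and> i \<in> ?W \<and> j \<in> ?W \<and> amplitude i j S = 0}"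
  have fin: "finite (?X \<times> ?W \<times> ?W)"
    using finite_window by auto
  have "finite N"
    by (rule finite_subset[OF _ fin]) (auto simp: N_def)
  have "(\<Sum>S\<in>?X. const (?D S) * g S * fermion_bilinear A f S)
      = (\<Sum>(S, i, j)\<in>?X \<times> ?W \<times> ?W. const (?D S * A i j * amplitude i j S) * (g S * f (move i j S)))"
    by (simp add: A sum_distrib_left case_prod_unfold sum.cartesian_product const_mult mult_ac)
  also have "\<dots> = (\<Sum>(S, i, j)\<in>?X \<times> ?W \<times> ?W - N.
                     const (?D S * A i j * amplitude i j S) * (g S * f (move i j S)))"
    by (rule sum.mono_neutral_right) (use fin in \<open>auto simp: N_def\<close>)
  also have "\<dots> = (\<Sum>(S, i, j)\<in>?X \<times> ?W \<times> ?W - N.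
                     const (?D S * B i j * amplitude i j S) * (g (move i j S) * f S))"
  proof (rule sum.reindex_bij_witness[where i = "\<lambda>(S, i, j). (move i j S, j, i)"
                                        and j = "\<lambda>(S, i, j). (move i j S, j, i)"], goal_cases)
    case (1 p)
    thus ?case by (cases p) (simp add: N_def move_move)
  next
    case (2 p)
    thus ?case by (auto simp: N_def intro!: move_in_window) (metis amplitude_reverse)
  next
    case (3 p)
    thus ?case by (cases p) (simp add: N_def move_move)
  next
    case (4 p)
    thus ?case by (auto simp: N_def intro!: move_in_window) (metis amplitude_reverse)
  next
    case (5 p)
    then obtain S i j where p: "p = (S, i, j)" "i \<in> ?W" "j \<in> ?W" "amplitude i j S \<noteq> 0"
      by (cases p) (auto simp: N_def)
    have "(?D (move i j S) * B j i) * (d i * d j) = ?D (move i j S) * d i * (B j i * d j)"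
      by (simp add: mult_ac)
    also have "\<dots> = (?D S * A i j) * (d i * d j)"
      unfolding weight_move[OF p(2-4)] AB[of i j, symmetric] by (simp add: mult_ac)
    finally have "?D (move i j S) * B j i = ?D S * A i j"
      using d by simp
    thus ?case
      using p by (simp add: amplitude_reverse move_move)
  qed
  also have "\<dots> = (\<Sum>(S, i, j)\<in>?X \<times> ?W \<times> ?W.
                     const (?D S * B i j * amplitude i j S) * (g (move i j S) * f S))"
    by (rule sum.mono_neutral_left) (use fin in \<open>auto simp: N_def\<close>)
  also have "\<dots> = (\<Sum>S\<in>?X. const (?D S) * fermion_bilinear B g S * f S)"
    by (simp add: B sum_distrib_left sum_distrib_right case_prod_unfold sum.cartesian_product
          const_mult mult_ac)
  finally show ?thesis .
qed

lemma hamiltonian_supported: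
  assumes "a \<le> 0" "0 \<le> b" "\<And>k i j. k \<ge> 1 \<Longrightarrow> j < i \<Longrightarrow> K k i j = 0"
    and "supported_on (window a b) g"
  shows "supported_on (window a b) (hamiltonian K g)"
proof -
  have supp: "supported_on (window a b) (fermion_bilinear (K k) g)" if "k \<ge> 1" for k
    using that assms by (intro fermion_bilinear_supported) auto
  have "hamiltonian K g S = formal_sum (\<lambda>k :: nat. 0)" if "S \<notin> window a b" for S
    unfolding hamiltonian_def
    by (rule arg_cong[where f = formal_sum])
       (use that supp in \<open>auto simp: supported_on_def\<close>)
  thus ?thesis
    by (auto simp: supported_on_def formal_sum.rep_eq intro!: pseries_eqI)
qed

lemma sum_hamiltonian:
  assumes "finite X"
  shows "(\<Sum>S\<in>X. c S * hamiltonian K f S) = formal_sum (\<lambda>k :: nat.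
     if k \<ge> 1 then const (1 / of_nat k) * pvar k * (\<Sum>S\<in>X. c S * fermion_bilinear (K k) f S) else 0)"
proof -
  have "(\<Sum>S\<in>X. c S * hamiltonian K f S) = (\<Sum>S\<in>X. formal_sum (\<lambda>k. c S *
          (if k \<ge> 1 then const (1 / of_nat k) * pvar k * fermion_bilinear (K k) f S else 0)))"
    unfolding hamiltonian_def by (simp only: formal_sum_mult locally_finite_pvar)
  also have "\<dots> = formal_sum (\<lambda>k. \<Sum>S\<in>X. c S *
          (if k \<ge> 1 then const (1 / of_nat k) * pvar k * fermion_bilinear (K k) f S else 0))"
    by (intro formal_sum_sum[symmetric] assms locally_finite_mult locally_finite_pvar)
  also have "\<dots> = formal_sum (\<lambda>k :: nat.
     if k \<ge> 1 then const (1 / of_nat k) * pvar k * (\<Sum>S\<in>X. c S * fermion_bilinear (K k) f S) else 0)"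
    by (intro arg_cong[where f = formal_sum]) (auto simp: sum_distrib_left mult_ac)
  finally show ?thesis .
qed

lemma hamiltonian_adjoint:
  assumes "a \<le> 0" "0 \<le> b" "supported_on (window a b) g" "\<And>i. d i \<noteq> 0"
    and "\<And>k i j. k \<ge> 1 \<Longrightarrow> j < i \<Longrightarrow> B k i j = 0"
    and "\<And>k i j. k \<ge> 1 \<Longrightarrow> A k j i * d j = B k i j * d i"
  shows "(\<Sum>S\<in>window a b. const (weight d a b S) * g S * hamiltonian A f S)
       = (\<Sum>S\<in>window a b. const (weight d a b S) * hamiltonian B g S * f S)"
proof -
  have eq: "(\<Sum>S\<in>window a b. const (weight d a b S) * g S * fermion_bilinear (A k) f S)
      = (\<Sum>S\<in>window a b. const (weight d a b S) * f S * fermion_bilinear (B k) g S)" if "k \<ge> 1" for k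
    using fermion_bilinear_adjoint[of a b g d "B k" "A k" f] assms that by (simp add: mult_ac)
  have "(\<Sum>S\<in>window a b. const (weight d a b S) * g S * hamiltonian A f S)
      = (\<Sum>S\<in>window a b. const (weight d a b S) * f S * hamiltonian B g S)"
    unfolding sum_hamiltonian[OF finite_window]
    by (intro arg_cong[where f = formal_sum]) (auto simp: fun_eq_iff eq)
  thus ?thesis
    by (simp add: mult_ac)
qed

text \<open>
  The powers are shifted one by one from \<open>f\<close> to \<open>g\<close>: under the lowering operator \<open>B\<close> the images of
  \<open>g\<close> stay supported on the window, whereas those of \<open>f\<close> under the raising operator \<open>A\<close> spread out.
\<close>

lemma hamiltonian_funpow_adjoint:
  assumes "a \<le> 0" "0 \<le> b" "supported_on (window a b) g" "\<And>i. d i \<noteq> 0"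
    and tri: "\<And>k i j. k \<ge> 1 \<Longrightarrow> j < i \<Longrightarrow> B k i j = 0"
    and AB: "\<And>k i j. k \<ge> 1 \<Longrightarrow> A k j i * d j = B k i j * d i"
  shows "(\<Sum>S\<in>window a b. const (weight d a b S) * g S * (hamiltonian A ^^ n) f S)
       = (\<Sum>S\<in>window a b. const (weight d a b S) * (hamiltonian B ^^ n) g S * f S)"
  using assms(3)
proof (induction n arbitrary: g)
  case (Suc n)
  have "(\<Sum>S\<in>window a b. const (weight d a b S) * g S * (hamiltonian A ^^ Suc n) f S)
      = (\<Sum>S\<in>window a b. const (weight d a b S) * hamiltonian B g S * (hamiltonian A ^^ n) f S)"
    using hamiltonian_adjoint[OF assms(1,2) Suc.prems assms(4) tri AB] by simp
  also have "\<dots> = (\<Sum>S\<in>window a b. const (weight d a b S) * (hamiltonian B ^^ n) (hamiltonian B g) S * f S)"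
    by (intro Suc.IH hamiltonian_supported assms(1,2) tri Suc.prems)
  finally show ?case
    by (simp add: funpow_swap1)
qed simp

lemma funpow_adjoint_ket:
  assumes "a \<le> 0" "0 \<le> b" "maya lam \<in> window a b" "maya mu \<in> window a b" "\<And>i. d i \<noteq> 0"
    and "\<And>k i j. k \<ge> 1 \<Longrightarrow> j < i \<Longrightarrow> B k i j = 0"
    and "\<And>k i j. k \<ge> 1 \<Longrightarrow> A k j i * d j = B k i j * d i"
  shows "const (weight d a b (maya lam)) * (hamiltonian A ^^ n) (ket mu) (maya lam)
       = const (weight d a b (maya mu)) * (hamiltonian B ^^ n) (ket lam) (maya mu)"
proof -
  have "supported_on (window a b) (ket lam)"
    using assms(3) by (auto simp: supported_on_def ket_def)
  from hamiltonian_funpow_adjoint[OF assms(1,2) this assms(5-7), where f = "ket mu" and n = n]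
  show ?thesis
    using assms(3,4) finite_window by (simp add: ket_def if_distrib if_distribR sum.delta cong: if_cong)
qed



section \<open>Particle-hole duality\<close>

text \<open>
  Exchanging particles and holes and reflecting the line by \<open>x \<mapsto> 1 - x\<close>, which fixes the vacuum
  \<open>{..0}\<close>.
\<close>

definition particle_hole :: "int set \<Rightarrow> int set" where
  "particle_hole S = {x. 1 - x \<notin> S}"

lemma particle_hole_involution [simp]: "particle_hole (particle_hole S) = S"
  by (auto simp: particle_hole_def)

lemma particle_hole_window: "S \<in> window a b \<Longrightarrow> particle_hole S \<in> window (-b) (-a)"
  by (auto simp: window_def particle_hole_def subset_iff) (smt (verit))+

lemma move_particle_hole:
  assumes "amplitude i j S \<noteq> 0"
  shows "move (1 - j) (1 - i) (particle_hole S) = particle_hole (move i j S)"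
  using amplitude_nonzeroD[OF assms] by (cases "i = j") (auto simp: move_def particle_hole_def)

text \<open>
  A particle hopping over the particles between \<open>i\<close> and \<open>j\<close> turns into a hole hopping over the holes
  between them, and there are \<open>\<bar>j - i\<bar> - 1\<close> places altogether. For \<open>i = j\<close> the sign comes from normal
  ordering, as particles and holes have opposite charges.
\<close>

lemma amplitude_particle_hole:
  "amplitude (1 - j) (1 - i) (particle_hole S) = - ((-1) ^ nat \<bar>j - i\<bar> * amplitude i j S)"
proof (cases "i \<noteq> j \<and> i \<in> S \<and> j \<notin> S")
  case True
  define I where "I = {min i j<..<max i j}"
  have "card (particle_hole S \<inter> {min (1 - j) (1 - i)<..<max (1 - j) (1 - i)}) = card (I - S)"
    by (rule bij_betw_same_card[of "\<lambda>x. 1 - x"],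
        rule bij_betwI[where g = "\<lambda>x. 1 - x"])
       (auto simp: particle_hole_def I_def min_def max_def split: if_splits)
  moreover have "card (S \<inter> I) + card (I - S) + 1 = nat \<bar>j - i\<bar>"
  proof -
    have "finite I"
      by (simp add: I_def)
    hence "card (S \<inter> I) + card (I - S) = card (S \<inter> I \<union> (I - S))"
      by (subst card_Un_disjoint) auto
    also have "S \<inter> I \<union> (I - S) = I"
      by auto
    finally have "card (S \<inter> I) + card (I - S) = card I" .
    thus ?thesis
      using True by (auto simp: I_def min_def max_def)
  qed
  hence "nat \<bar>j - i\<bar> = Suc (card (I - S) + card (S \<inter> I))"
    by simp
  ultimately show ?thesis
    using True
    by (simp add: amplitude_def particle_hole_def power_add minus_one_power_self flip: I_def)
qed (auto simp: amplitude_def particle_hole_def)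

definition bounded_maya :: "int set \<Rightarrow> bool" where
  "bounded_maya S \<longleftrightarrow> (\<exists>a b. S \<in> window a b)"

lemma bounded_maya_move:
  assumes "bounded_maya S"
  shows "bounded_maya (move i j S)"
proof -
  obtain a b where "S \<in> window a b"
    using assms by (auto simp: bounded_maya_def)
  hence "move i j S \<in> window (min a (i - 1)) (max b j)"
    by (fastforce simp: window_def move_def)
  thus ?thesis
    by (auto simp: bounded_maya_def)
qed

lemma fermion_bilinear_eq:
  assumes "bounded_maya S"
  shows "fermion_bilinear C f S = Sum_any (\<lambda>(i, j). const (C i j * amplitude i j S) * f (move i j S))"
proof -
  obtain b where "S \<subseteq> {..b}"
    using assms by (auto simp: bounded_maya_def window_def)
  thus ?thesis
    by (simp add: fermion_bilinear_def normal_ordered_eq const_mult_mult)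
qed

lemma bounded_maya_particle_hole: "bounded_maya S \<Longrightarrow> bounded_maya (particle_hole S)"
  using particle_hole_window unfolding bounded_maya_def by blast

text \<open>
  The sum is reindexed by \<open>(i, j) \<mapsto> (1 - j, 1 - i)\<close>, which matches it term by term. The sign
  \<open>(-1)\<^bsup>\<bar>j - i\<bar>\<^esup>\<close> in the relation between the matrices cancels the one in the amplitudes.
\<close>

lemma fermion_bilinear_particle_hole:
  assumes S: "bounded_maya S"
    and f: "\<And>T. bounded_maya T \<Longrightarrow> f' (particle_hole T) = omega (f T)"
    and C: "\<And>i j. C' (1 - j) (1 - i) = (-1) ^ (nat \<bar>j - i\<bar> + k) * C i j"
  shows "fermion_bilinear C' f' (particle_hole S)
       = const ((-1) ^ (k + 1)) * omega (fermion_bilinear C f S)"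
proof -
  let ?h = "\<lambda>x. const ((-1) ^ (k + 1)) * omega x"
  let ?l = "\<lambda>(i :: int, j :: int). (1 - j, 1 - i)"
  have "const (C' (1 - j) (1 - i) * amplitude (1 - j) (1 - i) (particle_hole S))
          * f' (move (1 - j) (1 - i) (particle_hole S))
      = ?h (const (C i j * amplitude i j S) * f (move i j S))" for i j
  proof (cases "amplitude i j S = 0")
    case False
    have "C' (1 - j) (1 - i) * amplitude (1 - j) (1 - i) (particle_hole S)
        = (-1) ^ (k + 1) * (C i j * amplitude i j S)"
      by (simp add: C amplitude_particle_hole power_add mult_ac minus_one_power_self)
    thus ?thesis
      using False
      by (simp add: move_particle_hole f bounded_maya_move S omega_mult const_mult_mult mult.assoc)
  qed (simp add: amplitude_particle_hole)
  hence "(\<lambda>(i, j). const (C' i j * amplitude i j (particle_hole S)) * f' (move i j (particle_hole S))) \<circ> ?l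
       = (\<lambda>p. ?h (case p of (i, j) \<Rightarrow> const (C i j * amplitude i j S) * f (move i j S)))"
    by (auto simp: fun_eq_iff)
  moreover have "bij ?l"
    by (rule o_bij[where g = ?l]) auto
  ultimately have "fermion_bilinear C' f' (particle_hole S)
      = Sum_any (\<lambda>p. ?h (case p of (i, j) \<Rightarrow> const (C i j * amplitude i j S) * f (move i j S)))"
    unfolding fermion_bilinear_eq[OF bounded_maya_particle_hole[OF S]] by (intro Sum_any.reindex_cong)
  also have "\<dots> = ?h (fermion_bilinear C f S)"
    unfolding fermion_bilinear_eq[OF S]
  proof (rule Sum_any_hom)
    show "x = 0" if "?h x = 0" for x
      using const_mult_eq_0[OF that] omega_eq_0 by simp
  qed (simp_all add: omega_add distrib_left)
  finally show ?thesis .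
qed

text \<open>
  The sign \<open>(-1)\<^bsup>k+1\<^esup>\<close> left over in \<open>fermion_bilinear_particle_hole\<close> is the one in
  \<open>\<omega> p\<^sub>k = (-1)\<^bsup>k+1\<^esup> p\<^sub>k\<close>.
\<close>

lemma hamiltonian_particle_hole:
  assumes S: "bounded_maya S"
    and f: "\<And>T. bounded_maya T \<Longrightarrow> f' (particle_hole T) = omega (f T)"
    and K: "\<And>k i j. k \<ge> 1 \<Longrightarrow> K' k (1 - j) (1 - i) = (-1) ^ (nat \<bar>j - i\<bar> + k) * K k i j"
  shows "hamiltonian K' f' (particle_hole S) = omega (hamiltonian K f S)"
proof -
  have "const (1 / of_nat k) * pvar k * fermion_bilinear (K' k) f' (particle_hole S)
      = omega (const (1 / of_nat k) * pvar k * fermion_bilinear (K k) f S)" if "k \<ge> 1" for k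
    using fermion_bilinear_particle_hole[where k = k and C = "K k" and C' = "K' k" and f = f and f' = f',
            OF S f K[OF that]] that
    by (simp add: omega_mult omega_pvar mult_ac)
  thus ?thesis
    unfolding hamiltonian_def formal_sum_omega[symmetric]
    by (intro arg_cong[where f = formal_sum]) auto
qed

lemma funpow_particle_hole:
  assumes f: "\<And>T. bounded_maya T \<Longrightarrow> f' (particle_hole T) = omega (f T)"
    and K: "\<And>k i j. k \<ge> 1 \<Longrightarrow> K' k (1 - j) (1 - i) = (-1) ^ (nat \<bar>j - i\<bar> + k) * K k i j"
    and S: "bounded_maya S"
  shows "(hamiltonian K' ^^ n) f' (particle_hole S) = omega ((hamiltonian K ^^ n) f S)"
  using S
proof (induction n arbitrary: S)
  case (Suc n)
  thus ?case
    using hamiltonian_particle_hole[of S "(hamiltonian K' ^^ n) f'" "(hamiltonian K ^^ n) f" K' K] K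
    by simp
qed (simp add: f)


section \<open>Symmetries of the current coefficients\<close>

lemma elem_sym_uminus: "elem_sym r I (\<lambda>a. - x a) = (-1) ^ r * elem_sym r I x"
  unfolding elem_sym_def sum_distrib_left
  by (rule sum.cong) (auto simp: prod_uminus)

lemma complete_sym_uminus: "complete_sym r I (\<lambda>a. - x a) = (-1) ^ r * complete_sym r I x"
proof -
  have "(\<Prod>a\<in>#M. - x a) = (-1) ^ size M * (\<Prod>a\<in>#M. x a)" for M
    by (induction M) (auto simp: mult_ac)
  thus ?thesis
    unfolding complete_sym_def sum_distrib_left
    by (intro sum.cong) (auto simp: multisets_of_size_def)
qed

lemma elem_sym_reflect: "elem_sym r {1 - j..1 - i} (\<lambda>a. x (1 - a)) = elem_sym r {i..j} x"
  unfolding elem_sym_def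
proof (rule sum.reindex_bij_witness[where i = "image ((-) 1)" and j = "image ((-) 1)"])
  fix X :: "int set"
  show "(\<Prod>a\<in>(-) 1 ` X. x a) = (\<Prod>a\<in>X. x (1 - a))"
    by (subst prod.reindex) (auto simp: inj_on_def)
qed (auto simp: image_image card_image inj_on_def)

lemma complete_sym_reflect:
  "complete_sym r {1 - j..1 - i} (\<lambda>a. x (1 - a)) = complete_sym r {i..j} x"
  unfolding complete_sym_def
  by (rule sum.reindex_bij_witness[where i = "image_mset ((-) 1)" and j = "image_mset ((-) 1)"])
     (auto simp: multisets_of_size_def multiset.map_comp o_def image_mset.compositionality)

lemma Sum_any_swap_pairs: "Sum_any (\<lambda>(r, s). F r s) = Sum_any (\<lambda>(s, r). F r s)"
  by (rule Sum_any.reindex_cong[of prod.swap]) (auto simp: fun_eq_iff)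

text \<open>
  The two generating functions of the coefficients agree under \<open>z \<mapsto> z\<^sup>-\<^sup>1\<close>, \<open>i \<leftrightarrow> j\<close> and \<open>\<alpha> \<leftrightarrow> \<beta>\<close>,
  except that the factor \<open>1 - \<alpha>\<beta>\<close> is always taken at the column index.
\<close>

lemma current_coeff_swap:
  assumes "k \<ge> 1"
  shows "current_coeff \<alpha> \<beta> (- int k) j i * (1 - \<alpha> j * \<beta> j)
       = current_coeff \<beta> \<alpha> (int k) i j * (1 - \<alpha> i * \<beta> i)"
proof -
  consider "i = j" | "i < j" | "j < i" by linarith
  thus ?thesis
  proof cases
    case 2
    have "Sum_any (\<lambda>(r, s). if int r - int s = i - j + int k
              then complete_sym r {i..j} \<alpha> * elem_sym s {i+1..j-1} (\<lambda>a. - \<beta> a) else 0)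
        = Sum_any (\<lambda>(r, s). if int r - int s = j - i - int k
              then elem_sym r {i+1..j-1} (\<lambda>a. - \<beta> a) * complete_sym s {i..j} \<alpha> else 0)"
      by (subst Sum_any_swap_pairs, intro Sum_any.cong) (auto simp: mult.commute)
    thus ?thesis
      using 2 assms by (simp add: current_coeff_def mult_ac)
  qed (use assms in \<open>simp_all add: current_coeff_def\<close>)
qed

text \<open>
  Here the column index \<open>1 - i\<close> on the left is reflected to the column index \<open>i\<close> on the right, so
  that the factors \<open>1 - \<alpha>\<beta>\<close> agree. Replacing the parameters by their negatives gives
  \<open>(-1)\<^bsup>r+s\<^esup>\<close>, which depends only on the parity of \<open>r - s\<close>.
\<close>

lemma current_coeff_neg_iota:
  assumes "k \<ge> 1"
  shows "current_coeff (neg_iota \<beta>) (neg_iota \<alpha>) (int k) (1 - j) (1 - i)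
       = (-1) ^ (nat \<bar>j - i\<bar> + k) * current_coeff \<alpha> \<beta> (- int k) j i"
proof -
  consider "i = j" | "i < j" | "j < i" by linarith
  thus ?thesis
  proof cases
    case 1
    have "(- \<alpha> i) ^ k = (-1) ^ k * \<alpha> i ^ k"
      by (rule power_minus)
    thus ?thesis
      using 1 assms by (simp add: current_coeff_def neg_iota_def)
  next
    case 2
    let ?e = "\<lambda>r. elem_sym r {i+1..j-1} (\<lambda>a. - \<beta> a)" and ?h = "\<lambda>s. complete_sym s {i..j} \<alpha>"
    have e: "elem_sym r {1 - j + 1..1 - i - 1} (\<lambda>a. - neg_iota \<beta> a) = (-1) ^ r * ?e r" for r
    proof -
      have "{1 - j + 1..1 - i - 1} = {1 - (j - 1)..1 - (i + 1)}"
        by auto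
      thus ?thesis
        using elem_sym_reflect[of r "j - 1" "i + 1" \<beta>]
        by (simp only: neg_iota_def elem_sym_uminus minus_minus minus_one_power_self)
    qed
    have h: "complete_sym s {1 - j..1 - i} (neg_iota \<alpha>) = (-1) ^ s * ?h s" for s
      using complete_sym_reflect[of s j i \<alpha>]
      by (simp add: neg_iota_def[abs_def] complete_sym_uminus)
    have sign: "(-1 :: complex) ^ r * (-1) ^ s = (-1) ^ (nat \<bar>j - i\<bar> + k)"
      if "int r - int s = j - i - int k" for r s
    proof -
      have "even (r + s) \<longleftrightarrow> even (int r - int s)"
        by simp
      also have "\<dots> \<longleftrightarrow> even (nat \<bar>j - i\<bar> + k)"
        unfolding that using 2 by (simp add: even_nat_iff)
      finally show ?thesis
        unfolding power_add[symmetric] by (simp only: minus_one_power_iff)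
    qed
    have "Sum_any (\<lambda>(r, s). if int r - int s = j - i - int k
              then elem_sym r {1 - j + 1..1 - i - 1} (\<lambda>a. - neg_iota \<beta> a)
                     * complete_sym s {1 - j..1 - i} (neg_iota \<alpha>) else 0)
        = Sum_any (\<lambda>p. (-1) ^ (nat \<bar>j - i\<bar> + k) *
              (case p of (r, s) \<Rightarrow> if int r - int s = j - i - int k then ?e r * ?h s else 0))"
      unfolding e h
      by (intro Sum_any.cong) (auto simp: sign[symmetric] mult_ac)
    also have "\<dots> = (-1) ^ (nat \<bar>j - i\<bar> + k) *
          Sum_any (\<lambda>(r, s). if int r - int s = j - i - int k then ?e r * ?h s else 0)"
      by (rule Sum_any_mult_nonzero) simp
    also have "Sum_any (\<lambda>(r, s). if int r - int s = j - i - int k then ?e r * ?h s else 0)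
        = Sum_any (\<lambda>(r, s). if int r - int s = i - j + int k then ?h r * ?e s else 0)"
      by (subst Sum_any_swap_pairs, intro Sum_any.cong) (auto simp: mult.commute)
    finally show ?thesis
      using 2 assms by (simp add: current_coeff_def neg_iota_def[of _ "1 - i"] mult_ac)
  qed (use assms in \<open>simp_all add: current_coeff_def\<close>)
qed


section \<open>Maya diagrams of conjugate partitions\<close>

lemma partition_antimono:
  assumes "is_partition lam" "1 \<le> i" "i \<le> j"
  shows "lam j \<le> lam i"
  using assms(3)
proof (induction j rule: dec_induct)
  case (step n)
  have "lam (Suc n) \<le> lam n"
    using assms(1,2) step.hyps by (simp add: is_partition_def)
  thus ?case
    using step.IH by simp
qed simp

lemma partition_eventually_0:
  assumes "is_partition lam" "i > part_length lam"
  shows "lam i = 0"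
proof (rule ccontr)
  assume "lam i \<noteq> 0"
  hence "{1..i} \<subseteq> {i. i \<ge> 1 \<and> lam i \<noteq> 0}"
    using partition_antimono[OF assms(1), of _ i] by fastforce
  moreover have "finite {i. i \<ge> 1 \<and> lam i \<noteq> 0}"
    using assms(1) by (simp add: is_partition_def)
  ultimately have "card {1..i} \<le> part_length lam"
    unfolding part_length_def by (intro card_mono)
  thus False
    using assms(2) by simp
qed

lemma finite_rows_ge:
  assumes "is_partition lam" "j \<ge> 1"
  shows "finite {i. i \<ge> 1 \<and> lam i \<ge> j}"
  by (rule finite_subset[of _ "{i. i \<ge> 1 \<and> lam i \<noteq> 0}"])
     (use assms in \<open>auto simp: is_partition_def\<close>)

lemma le_conjugate_iff:
  assumes "is_partition lam" "i \<ge> 1" "j \<ge> 1"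
  shows "i \<le> conjugate lam j \<longleftrightarrow> j \<le> lam i"
proof
  let ?R = "{i. i \<ge> 1 \<and> lam i \<ge> j}"
  show "i \<le> conjugate lam j" if "j \<le> lam i"
  proof -
    have "{1..i} \<subseteq> ?R"
      using that partition_antimono[OF assms(1), of _ i] by fastforce
    hence "card {1..i} \<le> card ?R"
      by (intro card_mono finite_rows_ge assms)
    thus ?thesis
      by (simp add: conjugate_def)
  qed
  show "j \<le> lam i" if "i \<le> conjugate lam j"
  proof (rule ccontr)
    assume "\<not> j \<le> lam i"
    hence "?R \<subseteq> {1..<i}"
      using partition_antimono[OF assms(1,2)] by (fastforce simp: not_le)
    hence "card ?R \<le> card {1..<i}"
      by (intro card_mono) auto
    thus False
      using that assms(2) by (simp add: conjugate_def)
  qed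
qed

lemma is_partition_conjugate:
  assumes "is_partition lam"
  shows "is_partition (conjugate lam)"
  unfolding is_partition_def
proof (intro conjI allI impI)
  fix j :: nat assume "j \<ge> 1"
  thus "conjugate lam (Suc j) \<le> conjugate lam j"
    unfolding conjugate_def by (intro card_mono finite_rows_ge assms) auto
next
  have "j \<le> lam 1" if "j \<ge> 1" "conjugate lam j \<noteq> 0" for j
    using le_conjugate_iff[OF assms, of 1 j] that by simp
  hence "{j. j \<ge> 1 \<and> conjugate lam j \<noteq> 0} \<subseteq> {..lam 1}"
    by auto
  thus "finite {j. j \<ge> 1 \<and> conjugate lam j \<noteq> 0}"
    by (rule finite_subset) simp
qed

text \<open>
  Particles and holes record the vertical and horizontal steps of the boundary of the diagram, so
  that the holes are given by the columns. The equation \<open>\<lambda>\<^sub>i - i + 1 = j - \<lambda>'\<^sub>j\<close> is impossible since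
  the box \<open>(i, j)\<close> is either inside the diagram, and then \<open>\<lambda>\<^sub>i + \<lambda>'\<^sub>j \<ge> i + j\<close>, or outside, and then
  \<open>\<lambda>\<^sub>i + \<lambda>'\<^sub>j \<le> i + j - 2\<close>. Conversely, a place \<open>c\<close> without particle is reached by the column that
  ends just above the first row \<open>i\<close> with \<open>\<lambda>\<^sub>i - i + 1 < c\<close>.
\<close>

lemma compl_maya:
  assumes "is_partition lam"
  shows "- maya lam = (\<lambda>j. int j - int (conjugate lam j)) ` {1..}"
proof (intro equalityI subsetI)
  fix c assume "c \<in> (\<lambda>j. int j - int (conjugate lam j)) ` {1..}"
  then obtain j where j: "j \<ge> 1" "c = int j - int (conjugate lam j)"
    by auto
  have "c \<noteq> int (lam i) - int i + 1" if "i \<ge> 1" for i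
    using le_conjugate_iff[OF assms that j(1)] j(2) by linarith
  thus "c \<in> - maya lam"
    by (auto simp: maya_def)
next
  fix c assume c: "c \<in> - maya lam"
  define P where "P = (\<lambda>i. i \<ge> 1 \<and> int (lam i) - int i + 1 < c)"
  \<comment> \<open>A row beyond the length of \<open>\<lambda>\<close> that is far enough down witnesses that such rows exist.\<close>
  define n where "n = part_length lam + 1 + nat (2 - c)"
  have "lam n = 0"
    by (rule partition_eventually_0[OF assms]) (simp add: n_def)
  hence "P n"
    by (auto simp: P_def n_def)
  define i where "i = (LEAST i. P i)"
  have i: "i \<ge> 1" "int (lam i) - int i + 1 < c"
    using LeastI[of P, OF \<open>P n\<close>] by (auto simp: i_def P_def)
  \<comment> \<open>Solving \<open>c = j - \<lambda>'\<^sub>j\<close> with the expected column height \<open>i - 1\<close>.\<close>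
  define j where "j = nat (c + int i - 1)"
  have j: "int j = c + int i - 1" "j \<ge> 1" "lam i < j"
    using i by (auto simp: j_def)
  have "conjugate lam j < i"
    using le_conjugate_iff[OF assms i(1) j(2)] j(3) by linarith
  moreover have "i - 1 \<le> conjugate lam j"
  proof (cases "i = 1")
    case False
    hence i1: "i - 1 \<ge> 1" using i(1) by simp
    have "\<not> P (i - 1)"
      using not_less_Least[of "i - 1" P] i(1) by (simp add: i_def)
    moreover have "c \<noteq> int (lam (i - 1)) - int (i - 1) + 1"
      using c i1 unfolding maya_def by blast
    ultimately have "j \<le> lam (i - 1)"
      using i1 j(1) i(1) by (auto simp: P_def of_nat_diff)
    thus ?thesis
      using le_conjugate_iff[OF assms i1 j(2)] by simp
  qed simp
  ultimately have "c = int j - int (conjugate lam j)"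
    using j(1) by linarith
  thus "c \<in> (\<lambda>j. int j - int (conjugate lam j)) ` {1..}"
    using j(2) by auto
qed

lemma maya_conjugate:
  assumes "is_partition lam"
  shows "maya (conjugate lam) = particle_hole (maya lam)"
proof (intro set_eqI)
  fix x
  have "x \<in> particle_hole (maya lam) \<longleftrightarrow> 1 - x \<in> - maya lam"
    by (simp add: particle_hole_def)
  also have "\<dots> \<longleftrightarrow> (\<exists>j\<ge>1. 1 - x = int j - int (conjugate lam j))"
    unfolding compl_maya[OF assms] by auto
  also have "\<dots> \<longleftrightarrow> (\<exists>j\<ge>1. x = int (conjugate lam j) - int j + 1)"
    by (intro ex_cong1 conj_cong) auto
  also have "\<dots> \<longleftrightarrow> x \<in> maya (conjugate lam)"
    by (auto simp: maya_def)
  finally show "x \<in> maya (conjugate lam) \<longleftrightarrow> x \<in> particle_hole (maya lam)"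
    by simp
qed

lemma maya_in_window:
  assumes "is_partition lam" "part_length (conjugate lam) \<le> m" "conjugate lam 1 \<le> l"
  shows "maya lam \<in> window (- int l) (int m)"
proof -
  note part = is_partition_conjugate[OF assms(1)]
  have "c \<in> maya lam" if "c \<le> - int l" for c
  proof (rule ccontr)
    assume "c \<notin> maya lam"
    then obtain j where "j \<ge> 1" "c = int j - int (conjugate lam j)"
      using compl_maya[OF assms(1)] by auto
    thus False
      using partition_antimono[OF part, of 1 j] assms(3) that by simp
  qed
  moreover have "c \<le> int m" if "c \<in> maya lam" for c
  proof (rule ccontr)
    assume "\<not> c \<le> int m"
    hence c: "nat c > m" "int (nat c) = c"
      by auto
    have "conjugate lam (nat c) = 0"
      by (rule partition_eventually_0[OF part]) (use c assms(2) in simp)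
    hence "c = int (nat c) - int (conjugate lam (nat c))"
      using c by simp
    hence "c \<in> - maya lam"
      unfolding compl_maya[OF assms(1)] using c(1) by (intro image_eqI[of _ _ "nat c"]) auto
    thus False
      using that by simp
  qed
  ultimately show ?thesis
    by (auto simp: window_def)
qed

text \<open>
  Each place in \<open>{-l<..m}\<close> is a particle or a hole, and the holes there are the \<open>j - \<lambda>'\<^sub>j\<close> with \<open>j \<le> m\<close>.
  This turns quotients of weights into the product over columns.
\<close>

lemma weight_maya:
  assumes "is_partition lam" "part_length (conjugate lam) \<le> m" "conjugate lam 1 \<le> l"
  shows "weight d (- int l) (int m) (maya lam) * (\<Prod>j = 1..m. d (int j - int (conjugate lam j)))
       = (\<Prod>x\<in>{- int l<..int m}. d x)"
proof -
  note part = is_partition_conjugate[OF assms(1)]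
  let ?g = "\<lambda>j. int j - int (conjugate lam j)" and ?W = "{- int l<..int m}"
  have mono: "conjugate lam j \<le> conjugate lam i" if "1 \<le> i" "i \<le> j" for i j
    using partition_antimono[OF part that] .
  have inj: "inj_on ?g {1..m}"
  proof (rule inj_onI)
    fix x y assume "x \<in> {1..m}" "y \<in> {1..m}" "?g x = ?g y"
    thus "x = y"
      using mono[of x y] mono[of y x] by (cases x y rule: linorder_cases) auto
  qed
  have "?W - maya lam = ?g ` {1..m}"
  proof -
    have inside: "?g j \<in> ?W \<longleftrightarrow> j \<le> m" if "j \<ge> 1" for j
      using mono[of 1 j] assms(2,3) that partition_eventually_0[OF part, of j]
      by (cases "j \<le> m") auto
    have "?W \<inter> ?g ` {1..} = ?g ` {j \<in> {1..}. ?g j \<in> ?W}"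
      by blast
    also have "{j \<in> {1..}. ?g j \<in> ?W} = {1..m}"
      using inside by (auto simp del: greaterThanAtMost_iff)
    finally show ?thesis
      by (simp add: Diff_eq compl_maya[OF assms(1)])
  qed
  hence "(\<Prod>j = 1..m. d (?g j)) = prod d (?W - maya lam)"
    using inj by (simp add: prod.reindex)
  moreover have "prod d (maya lam \<inter> ?W) * prod d (?W - maya lam) = prod d ?W"
    by (subst prod.union_disjoint[symmetric]) (auto intro!: prod.cong)
  ultimately show ?thesis
    by (simp add: weight_def)
qed


section \<open>Duality for skew double factorial Schur functions\<close>

lemma ket_conjugate:
  assumes "is_partition lam"
  shows "ket (conjugate lam) (particle_hole T) = omega (ket lam T)"
proof -
  have "particle_hole T = particle_hole (maya lam) \<longleftrightarrow> T = maya lam"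
    by (metis particle_hole_involution)
  thus ?thesis
    by (simp add: ket_def maya_conjugate[OF assms])
qed

lemma exp_op_omega:
  assumes "\<And>n. (H ^^ n) f S = omega ((H' ^^ n) f' S')"
  shows "exp_op H f S = omega (exp_op H' f' S')"
proof -
  have "const (1 / fact n) * (H ^^ n) f S = omega (const (1 / fact n) * (H' ^^ n) f' S')" for n
    by (simp add: assms omega_mult)
  thus ?thesis
    by (simp add: exp_op_def formal_sum_omega)
qed

lemma exp_op_const_mult:
  assumes "c \<noteq> 0" "\<And>n. (H ^^ n) f S = const c * (H' ^^ n) f' S'"
  shows "exp_op H f S = const c * exp_op H' f' S'"
proof -
  have "const (1 / fact n) * (H ^^ n) f S = const c * (const (1 / fact n) * (H' ^^ n) f' S')" for n
    by (simp add: assms mult_ac)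
  thus ?thesis
    by (simp add: exp_op_def formal_sum_const_mult assms(1))
qed

lemma current_coeff_minus_eq_0:
  "k \<ge> 1 \<Longrightarrow> j < i \<Longrightarrow> current_coeff \<alpha> \<beta> (- int k) j i = 0"
  and current_coeff_plus_eq_0: "k \<ge> 1 \<Longrightarrow> j < i \<Longrightarrow> current_coeff \<alpha> \<beta> (int k) i j = 0"
  by (simp_all add: current_coeff_def)

theorem theorem5p29:
  fixes \<alpha> \<beta> :: "int \<Rightarrow> complex" and lam mu :: "nat \<Rightarrow> nat" and m :: nat
  assumes "\<And>i. 1 - \<alpha> i * \<beta> i \<noteq> 0"
    and "is_partition lam" and "is_partition mu"
    and "m \<ge> max (part_length (conjugate lam)) (part_length (conjugate mu))"
  shows "dual_skew_schur \<alpha> \<beta> lam mu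
           = omega (skew_schur (neg_iota \<beta>) (neg_iota \<alpha>) (conjugate lam) (conjugate mu))
       \<and> omega (skew_schur (neg_iota \<beta>) (neg_iota \<alpha>) (conjugate lam) (conjugate mu))
           = const (\<Prod>i = 1..m.
               (1 - \<alpha> (int i - int (conjugate lam i)) * \<beta> (int i - int (conjugate lam i)))
               / (1 - \<alpha> (int i - int (conjugate mu i)) * \<beta> (int i - int (conjugate mu i))))
             * skew_schur \<beta> \<alpha> lam mu"
proof -
  define d where "d i = 1 - \<alpha> i * \<beta> i" for i
  define l where "l = max (conjugate lam 1) (conjugate mu 1)"
  let ?a = "- int l" and ?b = "int m"
  let ?A = "\<lambda>k. current_coeff \<alpha> \<beta> (- int k)"
  let ?B = "\<lambda>k i j. ?A k j i"
  let ?B' = "\<lambda>k. current_coeff \<beta> \<alpha> (int k)"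
  let ?C = "\<lambda>k. current_coeff (neg_iota \<beta>) (neg_iota \<alpha>) (int k)"
  have len: "part_length (conjugate lam) \<le> m" "part_length (conjugate mu) \<le> m"
    and l: "conjugate lam 1 \<le> l" "conjugate mu 1 \<le> l"
    using assms(4) by (auto simp: l_def)
  have d: "d i \<noteq> 0" for i
    using assms(1) by (simp add: d_def)
  have lam: "maya lam \<in> window ?a ?b" and mu: "maya mu \<in> window ?a ?b"
    using maya_in_window assms(2,3) len l by blast+

  \<comment> \<open>Transposing with trivial weights, then exchanging particles and holes.\<close>
  have "(hamiltonian ?A ^^ n) (ket mu) (maya lam) = (hamiltonian ?B ^^ n) (ket lam) (maya mu)" for n
    using funpow_adjoint_ket[of ?a ?b lam mu "\<lambda>_. 1" ?B ?A n] lam mu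
    by (simp add: weight_def current_coeff_minus_eq_0)
  also have "\<dots> n = omega ((hamiltonian ?C ^^ n) (ket (conjugate lam)) (maya (conjugate mu)))" for n
  proof -
    have "bounded_maya (maya mu)"
      using mu by (auto simp: bounded_maya_def)
    from funpow_particle_hole[where f = "ket lam" and K = ?B and K' = ?C,
        OF ket_conjugate[OF assms(2)] current_coeff_neg_iota this]
    show ?thesis
      by (simp add: maya_conjugate[OF assms(3)])
  qed
  finally have 1: "dual_skew_schur \<alpha> \<beta> lam mu
      = omega (skew_schur (neg_iota \<beta>) (neg_iota \<alpha>) (conjugate lam) (conjugate mu))"
    unfolding dual_skew_schur_def skew_schur_def bra_def H_plus_eq H_minus_eq
    by (rule exp_op_omega)

  \<comment> \<open>Transposing with the weights \<open>1 - \<alpha>\<beta>\<close> leads to the current for \<open>\<beta>; \<alpha>\<close> directly.\<close>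
  define w where "w = weight d ?a ?b"
  define c where "c = (\<Prod>i = 1..m. d (int i - int (conjugate lam i)) / d (int i - int (conjugate mu i)))"
  have "w (maya lam) \<noteq> 0" "c \<noteq> 0"
    using d by (auto simp: w_def weight_def c_def)
  have "w (maya mu) = w (maya lam) * c"
    using weight_maya[OF assms(2) len(1) l(1), of d] weight_maya[OF assms(3) len(2) l(2), of d] d
    by (simp add: w_def c_def prod_dividef field_simps)
  have "(hamiltonian ?A ^^ n) (ket mu) (maya lam)
      = const c * (hamiltonian ?B' ^^ n) (ket lam) (maya mu)" for n
  proof -
    have "const (w (maya lam)) * (hamiltonian ?A ^^ n) (ket mu) (maya lam)
        = const (w (maya mu)) * (hamiltonian ?B' ^^ n) (ket lam) (maya mu)"
      unfolding w_def
      by (rule funpow_adjoint_ket)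
         (use lam mu d current_coeff_swap current_coeff_plus_eq_0 in \<open>auto simp: d_def\<close>)
    hence "const (w (maya lam)) * ((hamiltonian ?A ^^ n) (ket mu) (maya lam)
        - const c * (hamiltonian ?B' ^^ n) (ket lam) (maya mu)) = 0"
      by (simp add: \<open>w (maya mu) = w (maya lam) * c\<close> const_mult algebra_simps)
    thus ?thesis
      using const_mult_eq_0 \<open>w (maya lam) \<noteq> 0\<close> by fastforce
  qed
  hence "dual_skew_schur \<alpha> \<beta> lam mu = const c * skew_schur \<beta> \<alpha> lam mu"
    unfolding dual_skew_schur_def skew_schur_def bra_def H_plus_eq H_minus_eq
    by (rule exp_op_const_mult[OF \<open>c \<noteq> 0\<close>])
  with 1 show ?thesis
    by (simp add: c_def d_def)
qed

end
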